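(* Let $G$ be a group with finite generating set $S$ such that the language $\textnormal{Geo}(G,S)$ of geodesic words is regular. Then the geodesic infinite snake problem for $(G,S)$ is decidable. In particular, it is decidable for every finitely generated abelian group and every finitely generated hyperbolic group, with respect to every finite generating set.
   Context: Elements of $G$ are represented by words over the alphabet $S\cup S^{-1}$; $\overline{w}$ denotes the element represented by $w$. A word $w$ is geodesic if $|w|\le|v|$ for every word $v$ with $\overline{v}=\overline{w}$; $\textnormal{Geo}(G,S)$ is the set of geodesic words. A tileset graph for $(G,S)$ is a finite multigraph $\Gamma=(A,B)$ whose edges are triples $(a,a',s)$ with $a,a'\in A$, $s\in S\cup S^{-1}$ (initial vertex $a$, final vertex $a'$, label $s$), such that $(a,a',s)\in B$ implies $(a',a,s^{-1})\in B$. A bi-infinite $\Gamma$-snake is a pair $(\omega,\zeta)$ with $\omega:\mathbb{Z}\to G$ injective and $\zeta:\mathbb{Z}\to A$ such that for all $i$, $d\omega_i:=\omega(i)^{-1}\omega(i+1)\in S\cup S^{-1}$ and $(\zeta(i),\zeta(i+1),d\omega_i)\in B$. The geodesic infinite snake problem for $(G,S)$: given a tileset graph $\Gamma$, decide whether there exists a bi-infinite $\Gamma$-snake $(\omega,\zeta)$ such that every finite factor $d\omega_i d\omega_{i+1}\cdots d\omega_j$ of the sequence $d\omega\in(S\cup S^{-1})^{\mathbb{Z}}$ is a geodesic word. *)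

theory Defs
  imports "HOL-Algebra.Generated_Groups" "HOL-Library.Nat_Bijection" Complex_Main
begin

datatype recf = Zf | Sf | Proj nat | Comp recf "recf list" | Prec recf recf | Mn recf

inductive eval_rf :: "recf \<Rightarrow> nat list \<Rightarrow> nat \<Rightarrow> bool" where
  ev_Z: "eval_rf Zf xs 0"
| ev_S: "eval_rf Sf (x # xs) (Suc x)"
| ev_Proj: "i < length xs \<Longrightarrow> eval_rf (Proj i) xs (xs ! i)"
| ev_Comp: "list_all2 (\<lambda>g y. eval_rf g xs y) gs ys \<Longrightarrow> eval_rf f ys z
            \<Longrightarrow> eval_rf (Comp f gs) xs z"
| ev_Prec0: "eval_rf f xs y \<Longrightarrow> eval_rf (Prec f g) (0 # xs) y"
| ev_PrecS: "eval_rf (Prec f g) (n # xs) y \<Longrightarrow> eval_rf g (n # y # xs) z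
            \<Longrightarrow> eval_rf (Prec f g) (Suc n # xs) z"
| ev_Mn: "eval_rf f (n # xs) 0 \<Longrightarrow> (\<forall>m<n. \<exists>y. eval_rf f (m # xs) y \<and> 0 < y)
            \<Longrightarrow> eval_rf (Mn f) xs n"

text \<open>The generating set S is given by a duplicate-free enumeration ss.
  A letter (i, True) stands for ss!i, the letter (i, False) for its inverse.\<close>

type_synonym letter = "nat \<times> bool"

definition letters :: "'a list \<Rightarrow> letter set" where
  "letters ss = {(i, b). i < length ss}"

definition letter_val :: "('a, 'b) monoid_scheme \<Rightarrow> 'a list \<Rightarrow> letter \<Rightarrow> 'a" where
  "letter_val G ss l = (if snd l then ss ! fst l else inv\<^bsub>G\<^esub> (ss ! fst l))"

definition word_val :: "('a, 'b) monoid_scheme \<Rightarrow> 'a list \<Rightarrow> letter list \<Rightarrow> 'a" where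
  "word_val G ss w = foldr (\<lambda>l x. letter_val G ss l \<otimes>\<^bsub>G\<^esub> x) w \<one>\<^bsub>G\<^esub>"

definition geodesic :: "('a, 'b) monoid_scheme \<Rightarrow> 'a list \<Rightarrow> letter list \<Rightarrow> bool" where
  "geodesic G ss w \<longleftrightarrow> w \<in> lists (letters ss) \<and>
     (\<forall>v \<in> lists (letters ss). word_val G ss v = word_val G ss w \<longrightarrow> length w \<le> length v)"

definition Geo :: "('a, 'b) monoid_scheme \<Rightarrow> 'a list \<Rightarrow> letter list set" where
  "Geo G ss = {w. geodesic G ss w}"

definition regular_lang :: "'s set \<Rightarrow> 's list set \<Rightarrow> bool" where
  "regular_lang \<Sigma> L \<longleftrightarrow> L \<subseteq> lists \<Sigma> \<and>
     (\<exists>(Q :: nat set) q0 (\<delta> :: nat \<Rightarrow> 's \<Rightarrow> nat) F.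
        finite Q \<and> q0 \<in> Q \<and> (\<forall>q\<in>Q. \<forall>a\<in>\<Sigma>. \<delta> q a \<in> Q) \<and> F \<subseteq> Q \<and>
        (\<forall>w \<in> lists \<Sigma>. w \<in> L \<longleftrightarrow> fold (\<lambda>a q. \<delta> q a) w q0 \<in> F))"

text \<open>A tileset graph is given by its (finite) list of edges (a, a', s) with vertices
  in nat and labels letters; isolated vertices are irrelevant.\<close>

type_synonym tileset = "(nat \<times> nat \<times> letter) list"

definition tileset_graph :: "'a list \<Rightarrow> tileset \<Rightarrow> bool" where
  "tileset_graph ss E \<longleftrightarrow>
     (\<forall>(a, a', l) \<in> set E. l \<in> letters ss \<and> (a', a, (fst l, \<not> snd l)) \<in> set E)"

definition has_geodesic_snake :: "('a, 'b) monoid_scheme \<Rightarrow> 'a list \<Rightarrow> tileset \<Rightarrow> bool" where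
  "has_geodesic_snake G ss E \<longleftrightarrow>
     (\<exists>(\<omega> :: int \<Rightarrow> 'a) (\<zeta> :: int \<Rightarrow> nat) (d :: int \<Rightarrow> letter).
        inj \<omega> \<and> (\<forall>i. \<omega> i \<in> carrier G) \<and>
        (\<forall>i. d i \<in> letters ss \<and> \<omega> (i + 1) = \<omega> i \<otimes>\<^bsub>G\<^esub> letter_val G ss (d i)) \<and>
        (\<forall>i. (\<zeta> i, \<zeta> (i + 1), d i) \<in> set E) \<and>
        (\<forall>i j. i \<le> j \<longrightarrow> geodesic G ss (map d [i..j])))"

definition encode_tileset :: "tileset \<Rightarrow> nat" where
  "encode_tileset E =
     list_encode (concat (map (\<lambda>(a, a', i, b). [a, a', i, if b then 1 else 0]) E))"

definition geodesic_snake_decidable :: "('a, 'b) monoid_scheme \<Rightarrow> 'a list \<Rightarrow> bool" where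
  "geodesic_snake_decidable G ss \<longleftrightarrow>
     (\<exists>f. \<forall>E. tileset_graph ss E \<longrightarrow>
        eval_rf f [encode_tileset E] (if has_geodesic_snake G ss E then 1 else 0))"

definition fin_gen_set :: "('a, 'b) monoid_scheme \<Rightarrow> 'a list \<Rightarrow> bool" where
  "fin_gen_set G ss \<longleftrightarrow> distinct ss \<and> set ss \<subseteq> carrier G \<and> generate G (set ss) = carrier G"

definition word_length :: "('a, 'b) monoid_scheme \<Rightarrow> 'a list \<Rightarrow> 'a \<Rightarrow> nat" where
  "word_length G ss g = (LEAST n. \<exists>w \<in> lists (letters ss). length w = n \<and> word_val G ss w = g)"

definition word_dist :: "('a, 'b) monoid_scheme \<Rightarrow> 'a list \<Rightarrow> 'a \<Rightarrow> 'a \<Rightarrow> real" where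
  "word_dist G ss g h = real (word_length G ss (inv\<^bsub>G\<^esub> g \<otimes>\<^bsub>G\<^esub> h))"

definition gromov_product :: "('a, 'b) monoid_scheme \<Rightarrow> 'a list \<Rightarrow> 'a \<Rightarrow> 'a \<Rightarrow> 'a \<Rightarrow> real" where
  "gromov_product G ss w x y = (word_dist G ss w x + word_dist G ss w y - word_dist G ss x y) / 2"

definition hyperbolic_group :: "('a, 'b) monoid_scheme \<Rightarrow> bool" where
  "hyperbolic_group G \<longleftrightarrow> group G \<and> (\<exists>ts (\<delta>::real). fin_gen_set G ts \<and> 0 \<le> \<delta> \<and>
     (\<forall>w\<in>carrier G. \<forall>x\<in>carrier G. \<forall>y\<in>carrier G. \<forall>z\<in>carrier G.
        gromov_product G ts w x y \<ge>
          min (gromov_product G ts w x z) (gromov_product G ts w y z) - \<delta>))"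

end

theory Submission
  imports Defs "HOL-Library.Multiset"
begin

text \<open>
  A bi-infinite geodesic snake is a bi-infinite path of tileset edges all of whose finite label
  factors are geodesic; injectivity is then automatic. If an automaton recognises the geodesic
  words, a path with geodesic label that is longer than the number of pairs (edge, state) contains a
  cycle of the product graph, and repeating that cycle gives a snake. So it suffices to search the
  finitely many paths of one computable length.

  For abelian groups the non-geodesic words form an upward closed set in terms of letter counts, and
  Dickson's lemma yields regularity. For hyperbolic groups regularity follows from the finiteness of
  Cannon's cone types. As hyperbolicity is only assumed for one generating set, the fellow traveller
  property for another one comes from the stability of quasi-geodesics, which is proved
  directly from the four-point condition.
\<close>

section \<open>Computable functions\<close>

text \<open>Nothing about the group is ever computed. Decidability asks only that some
  \<open>recf\<close> term answers correctly, so the state count and transition table of an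
  automaton that is merely known to exist enter the program as constants; all that has to be
  programmed is unpacking an encoded edge list and running a finite table.

  Pumping yields geodesic words although the automaton knows nothing of cycles in the group: the
  accepted words with repeated cycle are geodesic, and geodesic words are closed under factors.

  The hyperbolicity inequality is never transferred to another generating set. Geodesics of the
  other set are viewed as quasi-geodesics in the hyperbolic metric, fellow travelling is proved
  there, and only this conclusion is carried back through the bi-Lipschitz comparison.\<close>

definition computable :: "nat \<Rightarrow> (nat list \<Rightarrow> nat) \<Rightarrow> bool" where
  "computable n f \<longleftrightarrow> (\<exists>r. \<forall>xs. length xs = n \<longrightarrow> eval_rf r xs (f xs))"

lemma computable_cong:
  assumes "computable n f" and "\<And>xs. length xs = n \<Longrightarrow> f xs = g xs"
  shows "computable n g"
  using assms unfolding computable_def by metis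

lemma computable_nth: "i < n \<Longrightarrow> computable n (\<lambda>xs. xs ! i)"
  unfolding computable_def by (auto intro: ev_Proj)

lemma computable_compose:
  assumes f: "computable (length gs) f" and gs: "\<forall>g\<in>set gs. computable n g"
  shows "computable n (\<lambda>xs. f (map (\<lambda>g. g xs) gs))"
proof -
  obtain r where r: "\<And>ys. length ys = length gs \<Longrightarrow> eval_rf r ys (f ys)"
    using f unfolding computable_def by blast
  obtain R where R: "\<And>g xs. g \<in> set gs \<Longrightarrow> length xs = n \<Longrightarrow> eval_rf (R g) xs (g xs)"
    using gs unfolding computable_def by metis
  have "eval_rf (Comp r (map R gs)) xs (f (map (\<lambda>g. g xs) gs))" if "length xs = n" for xs
  proof (rule ev_Comp)
    show "list_all2 (\<lambda>g y. eval_rf g xs y) (map R gs) (map (\<lambda>g. g xs) gs)"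
      using R that by (simp add: list_all2_conv_all_nth)
  qed (simp add: r)
  then show ?thesis unfolding computable_def by blast
qed

lemma computable_compose1:
  assumes "computable 1 (\<lambda>xs. g (xs ! 0))" "computable n f"
  shows "computable n (\<lambda>xs. g (f xs))"
  using computable_compose[of "[f]" "\<lambda>xs. g (xs ! 0)" n] assms by simp

lemma computable_compose2:
  assumes "computable 2 (\<lambda>xs. g (xs ! 0) (xs ! 1))" "computable n f1" "computable n f2"
  shows "computable n (\<lambda>xs. g (f1 xs) (f2 xs))"
  using computable_compose[of "[f1, f2]" "\<lambda>xs. g (xs ! 0) (xs ! 1)" n] assms
  by (simp add: numeral_2_eq_2)

lemma computable_compose3:
  assumes "computable 3 (\<lambda>xs. g (xs ! 0) (xs ! 1) (xs ! 2))"
    "computable n f1" "computable n f2" "computable n f3"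
  shows "computable n (\<lambda>xs. g (f1 xs) (f2 xs) (f3 xs))"
  using computable_compose[of "[f1, f2, f3]" "\<lambda>xs. g (xs ! 0) (xs ! 1) (xs ! 2)" n] assms
  by (simp add: numeral_2_eq_2 numeral_3_eq_3)

lemma computable_Suc1: "computable 1 (\<lambda>xs. Suc (xs ! 0))"
  unfolding computable_def
proof (intro exI allI impI)
  fix xs :: "nat list" assume "length xs = 1"
  then obtain x where "xs = [x]" by (auto simp: length_Suc_conv)
  then show "eval_rf Sf xs (Suc (xs ! 0))" by (simp add: ev_S)
qed

lemmas computable_Suc = computable_compose1[OF computable_Suc1]

lemma computable_const: "computable n (\<lambda>xs. c)"
proof (induction c)
  case 0
  then show ?case unfolding computable_def by (auto intro: ev_Z)
next
  case (Suc c)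
  then show ?case by (rule computable_Suc)
qed

lemma computable_rec_nat_list:
  assumes f: "computable n f" and g: "computable (Suc (Suc n)) g"
  shows "computable (Suc n) (\<lambda>xs. rec_nat (f (tl xs)) (\<lambda>k y. g (k # y # tl xs)) (hd xs))"
proof -
  obtain rf where rf: "\<And>ys. length ys = n \<Longrightarrow> eval_rf rf ys (f ys)"
    using f unfolding computable_def by blast
  obtain rg where rg: "\<And>ys. length ys = Suc (Suc n) \<Longrightarrow> eval_rf rg ys (g ys)"
    using g unfolding computable_def by blast
  have "eval_rf (Prec rf rg) (k # ys) (rec_nat (f ys) (\<lambda>k y. g (k # y # ys)) k)"
    if "length ys = n" for k ys
  proof (induction k)
    case 0
    then show ?case using that rf by (auto intro: ev_Prec0)
  next
    case (Suc k)
    then show ?case using that rg by (auto intro: ev_PrecS)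
  qed
  then have "\<forall>xs. length xs = Suc n \<longrightarrow> eval_rf (Prec rf rg) xs
      (rec_nat (f (tl xs)) (\<lambda>k y. g (k # y # tl xs)) (hd xs))"
    by (auto simp: length_Suc_conv)
  then show ?thesis unfolding computable_def by blast
qed

text \<open>\<open>Prec\<close> takes its recursion argument from the head of the list. Computing
  that head from the other arguments allows a recursion whose length is any computable function of
  them.\<close>

lemma computable_cons:
  assumes f: "computable (Suc n) f" and g: "computable n g"
  shows "computable n (\<lambda>xs. f (g xs # xs))"
proof -
  have *: "computable n (\<lambda>xs. f (map (\<lambda>g. g xs) (g # map (\<lambda>i xs. xs ! i) [0..<n])))"
    by (rule computable_compose) (use f g in \<open>auto intro: computable_nth\<close>)
  show ?thesis
  proof (rule computable_cong[OF *])
    fix xs :: "nat list" assume "length xs = n"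
    then have "map (\<lambda>i. xs ! i) [0..<n] = xs" by (auto intro: nth_equalityI)
    then show "f (map (\<lambda>g. g xs) (g # map (\<lambda>i xs. xs ! i) [0..<n])) = f (g xs # xs)"
      by (simp add: comp_def)
  qed
qed

lemma computable_rec_nat:
  assumes "computable n b" "computable n t" "computable (Suc (Suc n)) s"
  shows "computable n (\<lambda>xs. rec_nat (b xs) (\<lambda>k y. s (k # y # xs)) (t xs))"
  using computable_cons[OF computable_rec_nat_list[OF assms(1,3)] assms(2)] by simp

text \<open>Totality of \<open>f\<close> settles the side condition of \<open>Mn\<close>: below the
  least zero every value exists and is positive.\<close>

lemma computable_Least:
  assumes f: "computable (Suc n) f" and ex: "\<And>xs. length xs = n \<Longrightarrow> \<exists>k. f (k # xs) = 0"
  shows "computable n (\<lambda>xs. LEAST k. f (k # xs) = 0)"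
proof -
  obtain r where r: "\<And>ys. length ys = Suc n \<Longrightarrow> eval_rf r ys (f ys)"
    using f unfolding computable_def by blast
  have "eval_rf (Mn r) xs (LEAST k. f (k # xs) = 0)" if "length xs = n" for xs
  proof (rule ev_Mn)
    let ?k = "LEAST k. f (k # xs) = 0"
    have "f (?k # xs) = 0" using ex[OF that] by (rule LeastI_ex)
    then show "eval_rf r (?k # xs) 0" using r[of "?k # xs"] that by simp
    have "f (m # xs) > 0" if "m < ?k" for m using not_less_Least[OF that] by simp
    then show "\<forall>m<?k. \<exists>y. eval_rf r (m # xs) y \<and> 0 < y"
      using r that by (metis length_Cons)
  qed
  then show ?thesis unfolding computable_def by blast
qed

section \<open>Arithmetic and bounded search\<close>

lemma computable_if2:
  "computable 3 (\<lambda>xs. if xs ! 0 = 0 then xs ! 1 else xs ! 2)"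
proof -
  have "computable 3 (\<lambda>xs. rec_nat (xs ! 1) (\<lambda>k y. (k # y # xs) ! 4) (xs ! 0))"
    by (rule computable_rec_nat) (auto intro: computable_nth)
  then show ?thesis
  proof (rule computable_cong)
    fix xs :: "nat list"
    show "rec_nat (xs ! 1) (\<lambda>k y. (k # y # xs) ! 4) (xs ! 0) = (if xs ! 0 = 0 then xs ! 1 else xs ! 2)"
      by (cases "xs ! 0") auto
  qed
qed

lemmas computable_if = computable_compose3[OF computable_if2]

lemma computable_add2: "computable 2 (\<lambda>xs. xs ! 0 + xs ! 1)"
proof -
  have c: "computable 2 (\<lambda>xs. rec_nat (xs ! 0) (\<lambda>k y. Suc ((k # y # xs) ! 1)) (xs ! 1))"
    by (rule computable_rec_nat) (auto intro!: computable_nth computable_Suc)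
  have "rec_nat a (\<lambda>k y. Suc y) b = a + b" for a b :: nat by (induction b) auto
  then show ?thesis using computable_cong[OF c] by simp
qed

lemmas computable_add = computable_compose2[OF computable_add2]

lemma computable_mult2: "computable 2 (\<lambda>xs. xs ! 0 * xs ! 1)"
proof -
  have c: "computable 2 (\<lambda>xs. rec_nat 0 (\<lambda>k y. (k # y # xs) ! 1 + (k # y # xs) ! 2) (xs ! 1))"
    by (rule computable_rec_nat) (auto intro!: computable_nth computable_add computable_const)
  have "rec_nat 0 (\<lambda>k y. y + a) b = a * b" for a b :: nat by (induction b) auto
  then show ?thesis using computable_cong[OF c] by simp
qed

lemmas computable_mult = computable_compose2[OF computable_mult2]

lemma computable_power2: "computable 2 (\<lambda>xs. xs ! 0 ^ xs ! 1)"
proof -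
  have c: "computable 2 (\<lambda>xs. rec_nat 1 (\<lambda>k y. (k # y # xs) ! 1 * (k # y # xs) ! 2) (xs ! 1))"
    by (rule computable_rec_nat) (auto intro!: computable_nth computable_mult computable_const)
  have "rec_nat 1 (\<lambda>k y. y * a) b = a ^ b" for a b :: nat by (induction b) auto
  then show ?thesis using computable_cong[OF c] by simp
qed

lemmas computable_power = computable_compose2[OF computable_power2]

lemma computable_pred1: "computable 1 (\<lambda>xs. xs ! 0 - 1)"
proof -
  have c: "computable 1 (\<lambda>xs. rec_nat 0 (\<lambda>k y. (k # y # xs) ! 0) (xs ! 0))"
    by (rule computable_rec_nat) (auto intro!: computable_nth computable_const)
  have "rec_nat 0 (\<lambda>k y. k) b = b - 1" for b :: nat by (cases b) auto
  then show ?thesis using computable_cong[OF c] by simp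
qed

lemma computable_diff2: "computable 2 (\<lambda>xs. xs ! 0 - xs ! 1)"
proof -
  have c: "computable 2 (\<lambda>xs. rec_nat (xs ! 0) (\<lambda>k y. (k # y # xs) ! 1 - 1) (xs ! 1))"
    by (rule computable_rec_nat)
      (auto intro!: computable_nth computable_compose1[OF computable_pred1] simp del: One_nat_def)
  have "rec_nat a (\<lambda>k y. y - 1) b = a - b" for a b :: nat by (induction b) auto
  then show ?thesis using computable_cong[OF c] by simp
qed

lemmas computable_diff = computable_compose2[OF computable_diff2]

text \<open>An unbounded search for a witness might not stop, so \<open>?f\<close> also vanishes, by
  truncated subtraction, once the bound is reached. The least zero lies below the bound exactly when
  a witness does.\<close>

lemma computable_bex:
  assumes P: "computable (Suc n) P" and b: "computable n b"
  shows "computable n (\<lambda>xs. of_bool (\<exists>i<b xs. P (i # xs) \<noteq> 0))"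
proof -
  let ?f = "\<lambda>ys. if P ys = 0 then b (tl ys) - ys ! 0 else 0"
  have b': "computable (Suc n) (\<lambda>ys. b (tl ys))"
  proof -
    have *: "computable (Suc n) (\<lambda>xs. b (map (\<lambda>g. g xs) (map (\<lambda>i xs. xs ! Suc i) [0..<n])))"
      by (rule computable_compose) (use b in \<open>auto intro: computable_nth\<close>)
    show ?thesis
    proof (rule computable_cong[OF *])
      fix xs :: "nat list" assume "length xs = Suc n"
      then have "map (\<lambda>i. xs ! Suc i) [0..<n] = tl xs" by (auto intro!: nth_equalityI simp: nth_tl)
      then show "b (map (\<lambda>g. g xs) (map (\<lambda>i xs. xs ! Suc i) [0..<n])) = b (tl xs)"
        by (simp add: comp_def)
    qed
  qed
  have "computable n (\<lambda>xs. LEAST k. ?f (k # xs) = 0)"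
    by (rule computable_Least)
      (auto intro!: computable_if P b' computable_diff computable_nth computable_const exI[of _ "b _"])
  then have "computable n (\<lambda>xs. if b xs - (LEAST k. ?f (k # xs) = 0) = 0 then 0 else 1)"
    by (intro computable_if computable_diff b computable_const)
  then show ?thesis
  proof (rule computable_cong)
    fix xs :: "nat list"
    define l where "l = (LEAST k. ?f (k # xs) = 0)"
    have L: "?f (l # xs) = 0" unfolding l_def by (rule LeastI[of _ "b xs"]) simp
    have "l < b xs \<longleftrightarrow> (\<exists>i<b xs. P (i # xs) \<noteq> 0)"
    proof
      assume "l < b xs"
      moreover from this have "P (l # xs) \<noteq> 0" using L by (auto split: if_splits)
      ultimately show "\<exists>i<b xs. P (i # xs) \<noteq> 0" by blast
    next
      assume "\<exists>i<b xs. P (i # xs) \<noteq> 0"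
      then obtain i where i: "i < b xs" "P (i # xs) \<noteq> 0" by blast
      then have "l \<le> i" unfolding l_def by (intro Least_le) simp
      then show "l < b xs" using i by simp
    qed
    then have "(if b xs - l = 0 then 0 else 1) = of_bool (\<exists>i<b xs. P (i # xs) \<noteq> 0)"
      by (cases "l < b xs") (simp_all only: diff_is_0_eq of_bool_def not_less[symmetric] if_True if_False not_True_eq_False not_False_eq_True)
    then show "(if b xs - (LEAST k. ?f (k # xs) = 0) = 0 then 0 else 1) = of_bool (\<exists>i<b xs. P (i # xs) \<noteq> 0)"
      unfolding l_def .
  qed
qed

text \<open>The quotient is the least \<open>k\<close> with \<open>x < (k + 1) * y\<close>. Divisor
  0 is separated so that the search stops at 0, the value of \<open>div\<close> there.\<close>

lemma computable_div2: "computable 2 (\<lambda>xs. xs ! 0 div xs ! 1)"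
proof -
  let ?f = "\<lambda>ys. if ys ! 2 = 0 then 0 else Suc (ys ! 1) - (ys ! 0 + 1) * ys ! 2"
  have "computable 2 (\<lambda>xs. LEAST k. ?f (k # xs) = 0)"
  proof (rule computable_Least)
    show "computable (Suc 2) ?f"
      by (intro computable_if computable_diff computable_mult computable_add computable_Suc
          computable_nth computable_const) auto
    fix xs :: "nat list"
    have "?f (xs ! 0 # xs) = 0" by (cases "xs ! 1") auto
    then show "\<exists>k. ?f (k # xs) = 0" by blast
  qed
  then show ?thesis
  proof (rule computable_cong)
    fix xs :: "nat list"
    show "(LEAST k. ?f (k # xs) = 0) = xs ! 0 div xs ! 1"
    proof (rule Least_equality)
      show "?f (xs ! 0 div xs ! 1 # xs) = 0"
        using dividend_less_div_times[of "xs ! 1" "xs ! 0"] by (auto simp: algebra_simps)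
      fix k assume "?f (k # xs) = 0"
      then have "xs ! 1 = 0 \<or> xs ! 0 < (k + 1) * xs ! 1" by (auto split: if_splits)
      then show "xs ! 0 div xs ! 1 \<le> k"
        by (metis Suc_eq_plus1 div_by_0 le0 less_Suc_eq_le less_mult_imp_div_less)
    qed
  qed
qed

lemmas computable_div = computable_compose2[OF computable_div2]

lemma computable_mod2: "computable 2 (\<lambda>xs. xs ! 0 mod xs ! 1)"
proof -
  have "computable 2 (\<lambda>xs. xs ! 0 - xs ! 1 * (xs ! 0 div xs ! 1))"
    by (intro computable_diff computable_mult computable_div computable_nth) auto
  then show ?thesis by (simp add: minus_mult_div_eq_mod)
qed

lemmas computable_mod = computable_compose2[OF computable_mod2]

lemma computable_eq:
  assumes "computable n f" "computable n g"
  shows "computable n (\<lambda>xs. of_bool (f xs = g xs))"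
proof -
  have "computable n (\<lambda>xs. if f xs - g xs + (g xs - f xs) = 0 then 1 else 0)"
    by (intro computable_if computable_add computable_diff computable_const assms)
  then show ?thesis by (rule computable_cong) auto
qed

text \<open>A finite table is computable by nested case distinctions, however its entries were
  obtained. Through it the transitions and final states of an automaton enter a program.\<close>

lemma computable_finite_support:
  assumes "finite {x. h x \<noteq> 0}"
  shows "computable 1 (\<lambda>xs. h (xs ! 0))"
  using assms
proof (induction "{x. h x \<noteq> (0::nat)}" arbitrary: h rule: finite_induct)
  case empty
  then have "h x = 0" for x by blast
  then show ?case by (simp add: computable_const)
next
  case (insert a A)
  let ?h = "h(a := 0)"
  have "A = {x. ?h x \<noteq> 0}" using insert.hyps(2,4) by (auto simp: set_eq_iff)
  from insert.hyps(3)[OF this] have "computable 1 (\<lambda>xs. ?h (xs ! 0))" .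
  then have "computable 1 (\<lambda>xs. if of_bool (xs ! 0 = a) = (0::nat) then ?h (xs ! 0) else h a)"
    by (intro computable_if computable_eq computable_nth computable_const) auto
  then show ?case by (rule computable_cong) auto
qed

section \<open>Decoding of pairs and lists\<close>

definition code_hd :: "nat \<Rightarrow> nat" where "code_hd c = fst (prod_decode (c - 1))"
definition code_tl :: "nat \<Rightarrow> nat" where "code_tl c = snd (prod_decode (c - 1))"
definition code_drop :: "nat \<Rightarrow> nat \<Rightarrow> nat" where "code_drop c i = rec_nat c (\<lambda>_. code_tl) i"
definition code_nth :: "nat \<Rightarrow> nat \<Rightarrow> nat" where "code_nth c i = code_hd (code_drop c i)"
definition code_length :: "nat \<Rightarrow> nat" where "code_length c = (LEAST i. code_drop c i = 0)"

lemma code_drop_eq: "code_drop (list_encode xs) i = list_encode (drop i xs)"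
proof (induction i)
  case 0
  then show ?case by (simp add: code_drop_def)
next
  case (Suc i)
  \<comment> \<open>The empty list has code 0, and \<open>0 - 1 = 0\<close> decodes to a pair of
    zeros, so dropping past the end stays at 0.\<close>
  have "prod_decode 0 = (0, 0)" using prod_encode_inverse[of "(0, 0)"] by (simp add: prod_encode_def)
  then have tl: "code_tl (list_encode ys) = list_encode (tl ys)" for ys
    by (cases ys) (simp_all add: code_tl_def)
  show ?case using Suc tl[of "drop i xs"] by (simp add: code_drop_def drop_Suc tl_drop)
qed

lemma code_nth_eq: "i < length xs \<Longrightarrow> code_nth (list_encode xs) i = xs ! i"
  unfolding code_nth_def code_drop_eq by (simp add: Cons_nth_drop_Suc[symmetric] code_hd_def)

lemma code_length_eq: "code_length (list_encode xs) = length xs"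
  unfolding code_length_def code_drop_eq
proof (rule Least_equality)
  fix y assume "list_encode (drop y xs) = 0"
  then show "length xs \<le> y" by (cases "drop y xs") auto
qed simp

text \<open>The pairing runs through diagonals, coding \<open>(m, n)\<close> as
  \<open>triangle (m + n) + m\<close>. The diagonal of \<open>c\<close> is thus the last one
  starting at or before \<open>c\<close>, and minimization finds it; this replaces the recursive
  decoder by a visibly computable formula.\<close>

lemma prod_decode_triangle:
  assumes "s = (LEAST s. c < triangle (Suc s))"
  shows "prod_decode c = (c - triangle s, s - (c - triangle s))"
proof -
  obtain m n where mn: "prod_decode c = (m, n)" by (cases "prod_decode c")
  then have c: "c = triangle (m + n) + m"
    using prod_decode_inverse[of c] by (simp add: prod_encode_def)
  have mono: "triangle a \<le> triangle b" if "a \<le> b" for a b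
    using that by (induction rule: dec_induct) auto
  have "s = m + n"
    unfolding assms
  proof (rule Least_equality)
    show "c < triangle (Suc (m + n))" using c by simp
    fix y assume "c < triangle (Suc y)"
    then show "m + n \<le> y" using mono[of "Suc y" "m + n"] c by linarith
  qed
  then show ?thesis using mn c by simp
qed

lemma computable_triangle: "computable n f \<Longrightarrow> computable n (\<lambda>xs. triangle (f xs))"
  unfolding triangle_def by (intro computable_div computable_mult computable_Suc computable_const)

lemma computable_triangle_root:
  "computable 1 (\<lambda>xs. LEAST s. xs ! 0 < triangle (Suc s))"
proof -
  have "computable 1 (\<lambda>xs. LEAST s. (\<lambda>ys. Suc (ys ! 1) - triangle (Suc (ys ! 0))) (s # xs) = 0)"
  proof (rule computable_Least)
    show "computable (Suc 1) (\<lambda>ys. Suc (ys ! 1) - triangle (Suc (ys ! 0)))"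
      by (intro computable_diff computable_triangle computable_Suc computable_nth) auto
    fix xs :: "nat list"
    show "\<exists>k. (\<lambda>ys. Suc (ys ! 1) - triangle (Suc (ys ! 0))) (k # xs) = 0"
      by (rule exI[of _ "xs ! 0"]) simp
  qed
  then show ?thesis by (simp add: less_Suc_eq_le del: triangle_Suc) (simp add: less_Suc_eq_le)
qed

lemma computable_code_hd1: "computable 1 (\<lambda>xs. code_hd (xs ! 0))"
  unfolding code_hd_def prod_decode_triangle[OF refl] fst_conv
  by (intro computable_diff computable_triangle computable_compose1[OF computable_triangle_root]
      computable_nth computable_const) auto

lemma computable_code_tl1: "computable 1 (\<lambda>xs. code_tl (xs ! 0))"
  unfolding code_tl_def prod_decode_triangle[OF refl] snd_conv
  by (intro computable_diff computable_triangle computable_compose1[OF computable_triangle_root]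
      computable_nth computable_const) auto

lemma computable_code_drop2: "computable 2 (\<lambda>xs. code_drop (xs ! 0) (xs ! 1))"
proof -
  have "computable 2 (\<lambda>xs. rec_nat (xs ! 0) (\<lambda>k y. code_tl ((k # y # xs) ! 1)) (xs ! 1))"
    by (rule computable_rec_nat) (auto intro!: computable_nth computable_compose1[OF computable_code_tl1])
  then show ?thesis by (simp add: code_drop_def)
qed

lemmas computable_code_nth2 =
  computable_compose1[OF computable_code_hd1 computable_code_drop2, folded code_nth_def]

lemmas computable_code_nth = computable_compose2[OF computable_code_nth2]

lemma computable_code_length1: "computable 1 (\<lambda>xs. code_length (xs ! 0))"
proof -
  have "computable 1 (\<lambda>xs. LEAST i. (\<lambda>ys. code_drop (ys ! 1) (ys ! 0)) (i # xs) = 0)"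
  proof (rule computable_Least)
    show "computable (Suc 1) (\<lambda>ys. code_drop (ys ! 1) (ys ! 0))"
      by (intro computable_compose2[OF computable_code_drop2] computable_nth) auto
    fix xs :: "nat list"
    have "code_drop (xs ! 0) (length (list_decode (xs ! 0))) = 0"
      using code_drop_eq[of "list_decode (xs ! 0)"] by simp
    then show "\<exists>k. (\<lambda>ys. code_drop (ys ! 1) (ys ! 0)) (k # xs) = 0" by auto
  qed
  then show ?thesis by (simp add: code_length_def)
qed

lemmas computable_code_length = computable_compose1[OF computable_code_length1]

lemma computable_prod_encode:
  "computable n f \<Longrightarrow> computable n g \<Longrightarrow> computable n (\<lambda>xs. prod_encode (f xs, g xs))"
  unfolding prod_encode_def prod.case
  by (intro computable_add computable_triangle)

section \<open>Searching for paths in an encoded tileset\<close>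

text \<open>The list inside \<open>encode_tileset\<close>, named so that the entries of edge
  \<open>j\<close> can be addressed at positions \<open>4 * j\<close> to
  \<open>4 * j + 3\<close>.\<close>

definition flatten_tileset :: "tileset \<Rightarrow> nat list" where
  "flatten_tileset E = concat (map (\<lambda>(a, a', i, b). [a, a', i, if b then 1 else 0]) E)"

lemma length_flatten_tileset: "length (flatten_tileset E) = 4 * length E"
  by (induction E) (auto simp: flatten_tileset_def)

lemma nth_flatten_tileset:
  assumes "j < length E" "E ! j = (a, a', i, b)"
  shows "flatten_tileset E ! (4 * j) = a" "flatten_tileset E ! (4 * j + 1) = a'"
    "flatten_tileset E ! (4 * j + 2) = i" "flatten_tileset E ! (4 * j + 3) = of_bool b"
  using assms
proof (induction E arbitrary: j)
  case (Cons e E)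
  { case 1 then show ?case using Cons by (cases j) (auto simp: flatten_tileset_def split: prod.splits) }
  { case 2 then show ?case using Cons by (cases j) (auto simp: flatten_tileset_def split: prod.splits) }
  { case 3 then show ?case using Cons
      by (cases j) (auto simp: flatten_tileset_def numeral_2_eq_2 split: prod.splits) }
  { case 4 then show ?case using Cons
      by (cases j) (auto simp: flatten_tileset_def numeral_3_eq_3 split: prod.splits) }
qed auto

definition edge_count :: "nat \<Rightarrow> nat" where
  "edge_count e = code_length e div 4"

definition edge_digit :: "nat \<Rightarrow> nat \<Rightarrow> nat \<Rightarrow> nat" where
  "edge_digit e c i = c div edge_count e ^ i mod edge_count e"

definition edge_field :: "nat \<Rightarrow> nat \<Rightarrow> nat \<Rightarrow> nat" where
  "edge_field e j k = code_nth e (4 * j + k)"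

lemmas computable_basic =
  computable_add computable_mult computable_diff computable_power computable_div computable_mod
  computable_eq computable_if computable_code_length computable_code_nth computable_prod_encode
  computable_const

lemma computable_edge_count:
  "computable n f \<Longrightarrow> computable n (\<lambda>xs. edge_count (f xs))"
  unfolding edge_count_def by (intro computable_basic)

lemma computable_edge_digit:
  "computable n f \<Longrightarrow> computable n g \<Longrightarrow> computable n h \<Longrightarrow>
    computable n (\<lambda>xs. edge_digit (f xs) (g xs) (h xs))"
  unfolding edge_digit_def by (intro computable_basic computable_edge_count)

lemma computable_edge_field:
  "computable n f \<Longrightarrow> computable n g \<Longrightarrow> computable n h \<Longrightarrow>
    computable n (\<lambda>xs. edge_field (f xs) (g xs) (h xs))"
  unfolding edge_field_def by (intro computable_basic)

lemma encode_tileset_flatten: "encode_tileset E = list_encode (flatten_tileset E)"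
  by (simp add: encode_tileset_def flatten_tileset_def)

lemma edge_count_encode: "edge_count (encode_tileset E) = length E"
  by (simp add: encode_tileset_flatten edge_count_def code_length_eq length_flatten_tileset)

lemma edge_field_encode:
  assumes "j < length E" "E ! j = (a, a', i, b)"
  shows "edge_field (encode_tileset E) j 0 = a" "edge_field (encode_tileset E) j 1 = a'"
    "edge_field (encode_tileset E) j 2 = i" "edge_field (encode_tileset E) j 3 = of_bool b"
  using nth_flatten_tileset[OF assms] assms(1)
  by (simp_all add: edge_field_def encode_tileset_flatten code_nth_eq length_flatten_tileset)

text \<open>The induction splits off the least significant digit. The bound \<open>m ^ n\<close>
  makes quantification over edge sequences a bounded search.\<close>

lemma ex_number_with_digits:
  assumes "\<And>i. i < n \<Longrightarrow> g i < (m::nat)"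
  shows "\<exists>c<m ^ n. \<forall>i<n. c div m ^ i mod m = g i"
  using assms
proof (induction n arbitrary: g)
  case (Suc n)
  obtain c where c: "c < m ^ n" "\<forall>i<n. c div m ^ i mod m = g (Suc i)"
    using Suc.IH[of "\<lambda>i. g (Suc i)"] Suc.prems by auto
  have g0: "g 0 < m" using Suc.prems by auto
  let ?c = "g 0 + m * c"
  have "?c < m + m * c" using g0 by simp
  also have "\<dots> = m * Suc c" by simp
  also have "\<dots> \<le> m ^ Suc n" using c(1) mult_le_mono2[of "Suc c" "m ^ n" m] by simp
  finally have "?c < m ^ Suc n" .
  moreover have "?c div m ^ i mod m = g i" if "i < Suc n" for i
  proof (cases i)
    case 0
    then show ?thesis using g0 by simp
  next
    case (Suc k)
    have "?c div m ^ i = (?c div m) div m ^ k" by (simp add: Suc div_mult2_eq)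
    also have "?c div m = c" using g0 by simp
    finally show ?thesis using c(2) that Suc by simp
  qed
  ultimately show ?case by blast
qed auto

text \<open>A path of \<open>n\<close> edges of a tileset with \<open>m\<close> edges is stored as a number below \<open>m ^ n\<close>, whose
  base-\<open>m\<close> digits are the positions of the edges in the list.\<close>

lemma automaton_path_decidable:
  fixes \<delta> :: "nat \<Rightarrow> letter \<Rightarrow> nat" and ss :: "'a list"
  assumes Q: "finite Q" "q0 \<in> Q" "F \<subseteq> Q"
    and \<delta>: "\<forall>q\<in>Q. \<forall>a\<in>letters ss. \<delta> q a \<in> Q"
  shows "\<exists>f. \<forall>E. tileset_graph ss E \<longrightarrow> eval_rf f [encode_tileset E]
    (of_bool (\<exists>e. (\<forall>i\<le>length E * k. e i \<in> set E) \<and>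
      (\<forall>i<length E * k. fst (snd (e i)) = fst (e (Suc i))) \<and>
      fold (\<lambda>a q. \<delta> q a) (map (\<lambda>i. snd (snd (e i))) [0..<Suc (length E * k)]) q0 \<in> F))"
proof -
  \<comment> \<open>The transition table as a function of one number; the value 0 outside
    \<open>Q\<close> and the alphabet gives it finite support.\<close>
  define trans where "trans y = (case prod_decode y of (q, z) \<Rightarrow> case prod_decode z of (i, b) \<Rightarrow>
    if q \<in> Q \<and> i < length ss \<and> b < 2 then \<delta> q (i, b = 1) else 0)" for y
  have trans_eq: "trans (prod_encode (q, prod_encode (i, of_bool b))) = \<delta> q (i, b)"
    if "q \<in> Q" "i < length ss" for q i b
    using that by (auto simp: trans_def)
  have "{y. trans y \<noteq> 0} \<subseteq> (\<lambda>(q, i, b). prod_encode (q, prod_encode (i, b))) ` (Q \<times> {..<length ss} \<times> {..<2})"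
  proof
    fix y assume y: "y \<in> {y. trans y \<noteq> 0}"
    obtain q z where qz: "prod_decode y = (q, z)" by (cases "prod_decode y")
    obtain i b where ib: "prod_decode z = (i, b)" by (cases "prod_decode z")
    have "q \<in> Q \<and> i < length ss \<and> b < 2" using y qz ib by (auto simp: trans_def split: if_splits)
    moreover have "y = prod_encode (q, prod_encode (i, b))"
      using qz ib by (metis prod_decode_inverse)
    ultimately show "y \<in> (\<lambda>(q, i, b). prod_encode (q, prod_encode (i, b))) ` (Q \<times> {..<length ss} \<times> {..<2})"
      by (force simp: image_iff)
  qed
  then have "finite {y. trans y \<noteq> 0}"
    by (rule finite_subset) (use Q in auto)
  note computable_trans = computable_compose1[OF computable_finite_support[OF this]]
  have "finite {q. of_bool (q \<in> F) \<noteq> (0::nat)}"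
    using Q by (auto intro: finite_subset)
  note computable_final = computable_compose1[OF computable_finite_support[OF this]]

  \<comment> \<open>Arguments are position, path number, tileset code; \<open>step\<close> has the
    current state inserted after the position, as the recursion scheme dictates.\<close>
  define linked :: "nat list \<Rightarrow> nat" where "linked ys = of_bool (edge_field (ys ! 2) (edge_digit (ys ! 2) (ys ! 1) (ys ! 0)) 1 =
     edge_field (ys ! 2) (edge_digit (ys ! 2) (ys ! 1) (ys ! 0 + 1)) 0)" for ys
  have linked: "computable 3 linked"
    unfolding linked_def
    by (intro computable_basic computable_edge_field computable_edge_digit computable_nth) auto
  define step where "step ys = trans (prod_encode (ys ! 1,
      prod_encode (edge_field (ys ! 3) (edge_digit (ys ! 3) (ys ! 2) (ys ! 0)) 2,
                   edge_field (ys ! 3) (edge_digit (ys ! 3) (ys ! 2) (ys ! 0)) 3)))" for ys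
  have step: "computable 4 step"
    unfolding step_def
    by (intro computable_basic computable_trans computable_edge_field computable_edge_digit computable_nth) auto
  define run where "run xs = rec_nat q0 (\<lambda>i q. step (i # q # xs)) (edge_count (xs ! 1) * k + 1)" for xs
  have run: "computable 2 run"
    unfolding run_def
    by (intro computable_rec_nat computable_basic computable_edge_count computable_nth)
      (use step in \<open>auto simp: numeral_eq_Suc\<close>)
  \<comment> \<open>All links hold if no broken link exists: bounded existence is the quantifier
    available as a computable operation.\<close>
  define check where "check xs = (if of_bool (\<exists>i<edge_count (xs ! 1) * k. (if linked (i # xs) = 0 then 1 else 0) \<noteq> (0::nat)) = (0::nat)
     then of_bool (run xs \<in> F) else (0::nat))" for xs
  have check: "computable 2 check"
    unfolding check_def
    by (intro computable_basic computable_bex computable_final computable_edge_count computable_nth run)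
      (use linked in \<open>auto simp: numeral_eq_Suc\<close>)
  define answer :: "nat list \<Rightarrow> nat" where "answer xs = of_bool (\<exists>c<edge_count (xs ! 0) ^ (edge_count (xs ! 0) * k + 1). check (c # xs) \<noteq> 0)" for xs
  have "computable 1 answer"
    unfolding answer_def
    by (intro computable_basic computable_bex computable_edge_count computable_nth)
      (use check in \<open>auto simp: numeral_eq_Suc\<close>)
  then obtain f where f: "\<And>x. eval_rf f [x] (answer [x])"
    unfolding computable_def by (metis One_nat_def length_Cons list.size(3))

  have answer_eq: "answer [encode_tileset E] = of_bool (\<exists>e. (\<forall>i\<le>length E * k. e i \<in> set E) \<and>
      (\<forall>i<length E * k. fst (snd (e i)) = fst (e (Suc i))) \<and>
      fold (\<lambda>a q. \<delta> q a) (map (\<lambda>i. snd (snd (e i))) [0..<Suc (length E * k)]) q0 \<in> F)"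
    (is "_ = of_bool ?ex") if E: "tileset_graph ss E" for E
  proof -
    define n where "n = length E * k"
    define e where "e c i = E ! (c div length E ^ i mod length E)" for c i
    have check_iff: "check [c, encode_tileset E] \<noteq> 0 \<longleftrightarrow>
        (\<forall>i<n. fst (snd (e c i)) = fst (e c (Suc i))) \<and>
        fold (\<lambda>a q. \<delta> q a) (map (\<lambda>i. snd (snd (e c i))) [0..<Suc n]) q0 \<in> F"
      if ne: "length E > 0" for c
    proof -
      have digit: "edge_digit (encode_tileset E) c i < length E" for i
        using ne by (simp add: edge_digit_def edge_count_encode)
      have e: "E ! edge_digit (encode_tileset E) c i = e c i" for i
        by (simp add: e_def edge_digit_def edge_count_encode)
      have fields:
        "edge_field (encode_tileset E) (edge_digit (encode_tileset E) c i) 0 = fst (e c i)"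
        "edge_field (encode_tileset E) (edge_digit (encode_tileset E) c i) 1 = fst (snd (e c i))"
        "edge_field (encode_tileset E) (edge_digit (encode_tileset E) c i) 2 = fst (snd (snd (e c i)))"
        "edge_field (encode_tileset E) (edge_digit (encode_tileset E) c i) 3 = of_bool (snd (snd (snd (e c i))))"
        for i
        using edge_field_encode[OF digit[of i], of "fst (e c i)" "fst (snd (e c i))"
            "fst (snd (snd (e c i)))" "snd (snd (snd (e c i)))"] e[of i] by auto
      \<comment> \<open>Labels lie in the alphabet because \<open>E\<close> is a tileset graph; this
        keeps the run inside \<open>Q\<close>, where \<open>trans\<close> agrees with
        \<open>\<delta>\<close>.\<close>
      have lab: "snd (snd (e c i)) \<in> letters ss" for i
      proof -
        obtain a a' l where eq: "e c i = (a, a', l)" by (cases "e c i")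
        then have "(a, a', l) \<in> set E" using nth_mem[OF digit[of i]] e[of i] by simp
        then show ?thesis using E eq unfolding tileset_graph_def by fastforce
      qed
      have runs: "rec_nat q0 (\<lambda>i q. step (i # q # [c, encode_tileset E])) j =
            fold (\<lambda>a q. \<delta> q a) (map (\<lambda>i. snd (snd (e c i))) [0..<j]) q0 \<and>
          fold (\<lambda>a q. \<delta> q a) (map (\<lambda>i. snd (snd (e c i))) [0..<j]) q0 \<in> Q" for j
      proof (induction j)
        case (Suc j)
        let ?q = "fold (\<lambda>a q. \<delta> q a) (map (\<lambda>i. snd (snd (e c i))) [0..<j]) q0"
        have "step (j # ?q # [c, encode_tileset E]) = \<delta> ?q (snd (snd (e c j)))"
          using trans_eq[of ?q "fst (snd (snd (e c j)))" "snd (snd (snd (e c j)))"] Suc lab[of j]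
          by (simp add: step_def fields[simplified] fields letters_def case_prod_beta numeral_2_eq_2[symmetric] numeral_3_eq_3[symmetric])
        then show ?case using Suc \<delta> lab[of j] by simp
      qed (use Q in auto)
      have "run [c, encode_tileset E] = fold (\<lambda>a q. \<delta> q a) (map (\<lambda>i. snd (snd (e c i))) [0..<Suc n]) q0"
        using runs[of "Suc n"] unfolding run_def n_def by (simp only: nth_Cons_0 nth_Cons_Suc edge_count_encode One_nat_def add_Suc_right add_0_right)
      moreover have "linked [i, c, encode_tileset E] = 0 \<longleftrightarrow> fst (snd (e c i)) \<noteq> fst (e c (Suc i))" for i
        using fields[of i] fields[of "Suc i"] by (simp add: linked_def)
      ultimately show ?thesis
        unfolding check_def n_def by (auto simp: edge_count_encode)
    qed
    show ?thesis
    proof (cases "length E = 0")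
      \<comment> \<open>Without edges the search range is \<open>0 ^ 1 = 0\<close>, hence empty, and
        no path exists either, as \<open>e 0\<close> would have to be an edge.\<close>
      case True
      then show ?thesis by (auto simp: answer_def edge_count_encode)
    next
      case False
      have "(\<exists>c<length E ^ Suc n. check [c, encode_tileset E] \<noteq> 0) \<longleftrightarrow> ?ex"
      proof
        assume "\<exists>c<length E ^ Suc n. check [c, encode_tileset E] \<noteq> 0"
        then obtain c where "check [c, encode_tileset E] \<noteq> 0" by blast
        moreover have "e c i \<in> set E" for i using False by (simp add: e_def)
        ultimately show ?ex using check_iff[of c] False unfolding n_def by (intro exI[of _ "e c"]) auto
      next
        assume ?ex
        then obtain e' where e': "\<forall>i\<le>n. e' i \<in> set E" "\<forall>i<n. fst (snd (e' i)) = fst (e' (Suc i))"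
          "fold (\<lambda>a q. \<delta> q a) (map (\<lambda>i. snd (snd (e' i))) [0..<Suc n]) q0 \<in> F"
          unfolding n_def by blast
        obtain g where g: "\<And>i. i \<le> n \<Longrightarrow> g i < length E \<and> E ! g i = e' i"
          using e'(1) unfolding in_set_conv_nth by metis
        obtain c where c: "c < length E ^ Suc n" "\<And>i. i < Suc n \<Longrightarrow> c div length E ^ i mod length E = g i"
          using ex_number_with_digits[of "Suc n" g "length E"] g by auto
        have ee: "e c i = e' i" if "i \<le> n" for i using c(2)[of i] g[of i] that by (simp add: e_def)
        have "map (\<lambda>i. snd (snd (e c i))) [0..<Suc n] = map (\<lambda>i. snd (snd (e' i))) [0..<Suc n]"
          using ee by (auto simp del: upt_Suc)
        with e'(3) have "fold (\<lambda>a q. \<delta> q a) (map (\<lambda>i. snd (snd (e c i))) [0..<Suc n]) q0 \<in> F"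
          by (simp only:)
        then have "check [c, encode_tileset E] \<noteq> 0"
          using check_iff[of c] False e' ee by (simp del: upt_Suc)
        then show "\<exists>c<length E ^ Suc n. check [c, encode_tileset E] \<noteq> 0" using c(1) by blast
      qed
      then show ?thesis by (simp add: answer_def edge_count_encode n_def)
    qed
  qed
  show ?thesis
    by (intro exI[of _ f] allI impI) (use f in \<open>simp only: answer_eq[symmetric]\<close>)
qed

section \<open>Geodesic snakes and regularity\<close>

lemma finite_letters: "finite (letters ss)"
proof -
  have "letters ss = {..<length ss} \<times> UNIV" by (auto simp: letters_def)
  then show ?thesis by simp
qed

section \<open>Words and the elements they represent\<close>

lemma word_val_Nil [simp]: "word_val G ss [] = \<one>\<^bsub>G\<^esub>"
  by (simp add: word_val_def)

lemma word_val_Cons: "word_val G ss (l # w) = letter_val G ss l \<otimes>\<^bsub>G\<^esub> word_val G ss w"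
  by (simp add: word_val_def)

lemma geodesic_Nil: "geodesic G ss []"
  by (simp add: geodesic_def)

lemma geodesic_letters: "geodesic G ss w \<Longrightarrow> w \<in> lists (letters ss)"
  by (simp add: geodesic_def)

definition inverse_word :: "letter list \<Rightarrow> letter list" where
  "inverse_word w = rev (map (\<lambda>l. (fst l, \<not> snd l)) w)"

lemma length_inverse_word [simp]: "length (inverse_word w) = length w"
  by (simp add: inverse_word_def)

lemma inverse_word_letters: "w \<in> lists (letters ss) \<Longrightarrow> inverse_word w \<in> lists (letters ss)"
  by (auto simp: inverse_word_def in_lists_conv_set letters_def)

locale generated_group = group G for G :: "('a, 'b) monoid_scheme" (structure) +
  fixes ss :: "'a list"
  assumes gen: "fin_gen_set G ss"
begin

lemma letter_val_closed: "l \<in> letters ss \<Longrightarrow> letter_val G ss l \<in> carrier G"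
  using gen by (auto simp: letter_val_def letters_def fin_gen_set_def dest: nth_mem)

lemma word_val_closed: "w \<in> lists (letters ss) \<Longrightarrow> word_val G ss w \<in> carrier G"
  by (induction w) (auto simp: word_val_Cons letter_val_closed)

lemma word_val_append:
  "u \<in> lists (letters ss) \<Longrightarrow> v \<in> lists (letters ss) \<Longrightarrow>
    word_val G ss (u @ v) = word_val G ss u \<otimes> word_val G ss v"
  by (induction u) (auto simp: word_val_Cons letter_val_closed word_val_closed m_assoc)

lemma word_val_single: "l \<in> letters ss \<Longrightarrow> word_val G ss [l] = letter_val G ss l"
  by (simp add: word_val_Cons letter_val_closed)

lemma letter_val_inverse:
  "l \<in> letters ss \<Longrightarrow> letter_val G ss (fst l, \<not> snd l) = inv (letter_val G ss l)"
  using gen by (auto simp: letter_val_def letters_def fin_gen_set_def subset_iff)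

lemma word_val_inverse_word:
  "w \<in> lists (letters ss) \<Longrightarrow> word_val G ss (inverse_word w) = inv (word_val G ss w)"
proof (induction w)
  case (Cons l w)
  have l': "(fst l, \<not> snd l) \<in> letters ss" using Cons.prems by (auto simp: letters_def)
  have "inverse_word (l # w) = inverse_word w @ [(fst l, \<not> snd l)]"
    by (simp add: inverse_word_def)
  then have "word_val G ss (inverse_word (l # w)) = inv (word_val G ss w) \<otimes> inv (letter_val G ss l)"
    using Cons l' by (simp add: word_val_append inverse_word_letters word_val_single letter_val_inverse)
  then show ?case using Cons.prems
    by (simp add: word_val_Cons inv_mult_group letter_val_closed word_val_closed)
qed (simp add: inverse_word_def)

lemma word_val_surj:
  assumes "g \<in> carrier G"
  shows "\<exists>w\<in>lists (letters ss). word_val G ss w = g"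
proof -
  have "g \<in> generate G (set ss)" using assms gen by (simp add: fin_gen_set_def)
  then show ?thesis
  proof induction
    case one
    show ?case by (rule bexI[of _ "[]"]) auto
  next
    case (incl h)
    then obtain i where i: "i < length ss" "h = ss ! i" by (metis in_set_conv_nth)
    then have "(i, True) \<in> letters ss" by (simp add: letters_def)
    then show ?case using i
      by (intro bexI[of _ "[(i, True)]"]) (auto simp: word_val_single letter_val_def)
  next
    case (inv h)
    then obtain i where i: "i < length ss" "h = ss ! i" by (metis in_set_conv_nth)
    then have "(i, False) \<in> letters ss" by (simp add: letters_def)
    then show ?case using i
      by (intro bexI[of _ "[(i, False)]"]) (auto simp: word_val_single letter_val_def)
  next
    case (eng h1 h2)
    then obtain u v where "u \<in> lists (letters ss)" "v \<in> lists (letters ss)"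
      "word_val G ss u = h1" "word_val G ss v = h2" by blast
    then show ?case by (intro bexI[of _ "u @ v"]) (auto simp: word_val_append)
  qed
qed

text \<open>A shorter word for the factor could be substituted in the whole word without changing
  its value.\<close>

lemma geodesic_factor:
  assumes "geodesic G ss (u @ w @ v)"
  shows "geodesic G ss w"
proof -
  have l: "u \<in> lists (letters ss)" "w \<in> lists (letters ss)" "v \<in> lists (letters ss)"
    using geodesic_letters[OF assms] by auto
  have "length w \<le> length x" if x: "x \<in> lists (letters ss)" "word_val G ss x = word_val G ss w" for x
  proof -
    have "u @ x @ v \<in> lists (letters ss)" using l x by auto
    moreover have "word_val G ss (u @ x @ v) = word_val G ss (u @ w @ v)"
      using l x by (simp add: word_val_append)
    ultimately have "length (u @ w @ v) \<le> length (u @ x @ v)" using assms unfolding geodesic_def by blast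
    then show ?thesis by simp
  qed
  then show ?thesis using l by (simp add: geodesic_def)
qed

lemma geodesic_eq_one:
  assumes "geodesic G ss w" "word_val G ss w = \<one>"
  shows "w = []"
  using assms unfolding geodesic_def by (auto dest: bspec[of _ _ "[]"])

text \<open>The walk \<open>\<omega>\<close> is determined by its increments \<open>d\<close>, and geodesicity of the increments
  already makes it injective.\<close>

lemma has_geodesic_snake_iff:
  "has_geodesic_snake G ss E \<longleftrightarrow>
    (\<exists>e::int \<Rightarrow> nat \<times> nat \<times> letter. (\<forall>i. e i \<in> set E) \<and> (\<forall>i. fst (snd (e i)) = fst (e (i + 1))) \<and>
      (\<forall>i j. i \<le> j \<longrightarrow> geodesic G ss (map (\<lambda>k. snd (snd (e k))) [i..j])))"
proof
  assume "has_geodesic_snake G ss E"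
  then obtain \<omega> :: "int \<Rightarrow> 'a" and \<zeta> d where "\<forall>i. (\<zeta> i, \<zeta> (i + 1), d i) \<in> set E"
      "\<forall>i j. i \<le> j \<longrightarrow> geodesic G ss (map d [i..j])"
    unfolding has_geodesic_snake_def by blast
  then show "\<exists>e::int \<Rightarrow> nat \<times> nat \<times> letter. (\<forall>i. e i \<in> set E) \<and> (\<forall>i. fst (snd (e i)) = fst (e (i + 1))) \<and>
      (\<forall>i j. i \<le> j \<longrightarrow> geodesic G ss (map (\<lambda>k. snd (snd (e k))) [i..j]))"
    by (intro exI[of _ "\<lambda>i. (\<zeta> i, \<zeta> (i + 1), d i)"]) auto
next
  assume "\<exists>e::int \<Rightarrow> nat \<times> nat \<times> letter. (\<forall>i. e i \<in> set E) \<and> (\<forall>i. fst (snd (e i)) = fst (e (i + 1))) \<and>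
      (\<forall>i j. i \<le> j \<longrightarrow> geodesic G ss (map (\<lambda>k. snd (snd (e k))) [i..j]))"
  then obtain e :: "int \<Rightarrow> nat \<times> nat \<times> letter" where e: "\<And>i. e i \<in> set E"
    "\<And>i. fst (snd (e i)) = fst (e (i + 1))"
    and geo0: "\<And>i j. i \<le> j \<Longrightarrow> geodesic G ss (map (\<lambda>k. snd (snd (e k))) [i..j])"
    by blast
  define d where "d k = snd (snd (e k))" for k
  have geo: "geodesic G ss (map d [i..j])" for i j
    using geo0[of i j] geodesic_Nil by (cases "i \<le> j") (auto simp: d_def[abs_def])
  have dl: "d k \<in> letters ss" for k
    using geodesic_letters[OF geo[of k k]] by simp
  have cl: "word_val G ss (map d [i..j]) \<in> carrier G" for i j
    using geodesic_letters[OF geo] word_val_closed by blast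
  \<comment> \<open>The walk is at the identity at time 0. For negative \<open>k\<close> the word
    from \<open>k\<close> to -1 has to lead back there, whence the inverse.\<close>
  define \<omega> where "\<omega> k = (if k \<ge> 0 then word_val G ss (map d [0..k - 1])
      else inv (word_val G ss (map d [k..-1])))" for k
  have \<omega>c: "\<omega> k \<in> carrier G" for k using cl by (simp add: \<omega>_def)
  have \<omega>s: "\<omega> (k + 1) = \<omega> k \<otimes> letter_val G ss (d k)" for k
  proof (cases "k \<ge> 0")
    case True
    then have "map d [0..k + 1 - 1] = map d [0..k - 1] @ [d k]"
      using upto_rec2[of 0 k] by simp
    then show ?thesis using True geodesic_letters[OF geo[of 0 "k - 1"]] dl
      by (simp add: \<omega>_def word_val_append word_val_single)
  next
    case False
    let ?x = "letter_val G ss (d k)" and ?y = "word_val G ss (map d [k + 1..-1])"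
    have "map d [k..-1] = d k # map d [k + 1..-1]" using upto_rec1[of k "-1"] False by simp
    then have "\<omega> k = inv (?x \<otimes> ?y)" using False by (simp add: \<omega>_def word_val_Cons)
    also have "\<dots> = inv ?y \<otimes> inv ?x" using cl dl by (simp add: inv_mult_group letter_val_closed)
    finally have "\<omega> k \<otimes> ?x = inv ?y" using cl dl by (simp add: m_assoc letter_val_closed)
    moreover have "\<omega> (k + 1) = inv ?y" using False by (auto simp: \<omega>_def)
    ultimately show ?thesis by simp
  qed
  have \<omega>_shift: "\<omega> (i + int n) = \<omega> i \<otimes> word_val G ss (map d [i..i + int n - 1])" for i n
  proof (induction n)
    case (Suc n)
    have "[i..i + int (Suc n) - 1] = [i..i + int n - 1] @ [i + int n]"
      using upto_rec2[of i "i + int n"] by (simp add: algebra_simps)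
    moreover have "\<omega> (i + int (Suc n)) = \<omega> (i + int n) \<otimes> letter_val G ss (d (i + int n))"
      using \<omega>s[of "i + int n"] by (simp add: algebra_simps)
    ultimately show ?case
      using Suc \<omega>c cl dl geodesic_letters[OF geo[of i "i + int n - 1"]]
      by (simp add: word_val_append word_val_single m_assoc letter_val_closed)
  qed (simp add: \<omega>c)
  \<comment> \<open>A repetition would make a nonempty geodesic factor represent the
    identity.\<close>
  have "\<not> \<omega> i = \<omega> j" if "i < j" for i j
  proof
    assume eq: "\<omega> i = \<omega> j"
    have "\<omega> i = \<omega> i \<otimes> word_val G ss (map d [i..j - 1])"
      using \<omega>_shift[of i "nat (j - i)"] that eq by simp
    then have "word_val G ss (map d [i..j - 1]) = \<one>" using \<omega>c cl by simp
    then have "map d [i..j - 1] = []" by (intro geodesic_eq_one geo)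
    then show False using that by simp
  qed
  then have inj: "inj \<omega>" unfolding inj_def by (metis linorder_neqE_linordered_idom)
  have "(fst (e i), fst (e (i + 1)), d i) \<in> set E" for i
    using e(1)[of i] by (simp add: d_def flip: e(2))
  then show "has_geodesic_snake G ss E"
    unfolding has_geodesic_snake_def using inj \<omega>c \<omega>s dl geo
    by (intro exI[of _ \<omega>] exI[of _ "\<lambda>i. fst (e i)"] exI[of _ d]) auto
qed

text \<open>A path longer than the number of pairs (edge, state) runs through a cycle of the product of
  the tileset with the automaton; going around that cycle forever gives a snake.\<close>

lemma has_geodesic_snake_iff_long_path:
  assumes Q: "finite Q" "q0 \<in> Q" "F \<subseteq> Q"
    and \<delta>: "\<forall>q\<in>Q. \<forall>a\<in>letters ss. \<delta> q a \<in> Q"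
    and acc: "\<forall>w\<in>lists (letters ss). w \<in> Geo G ss \<longleftrightarrow> fold (\<lambda>a q. \<delta> q a) w q0 \<in> F"
    and E: "tileset_graph ss E"
  shows "has_geodesic_snake G ss E \<longleftrightarrow>
    (\<exists>e. (\<forall>i\<le>length E * card Q. e i \<in> set E) \<and>
      (\<forall>i<length E * card Q. fst (snd (e i)) = fst (e (Suc i))) \<and>
      fold (\<lambda>a q. \<delta> q a) (map (\<lambda>i. snd (snd (e i))) [0..<Suc (length E * card Q)]) q0 \<in> F)"
    (is "_ \<longleftrightarrow> (\<exists>e. ?path e)")
proof
  let ?N = "length E * card Q"
  have edge_letter: "snd (snd x) \<in> letters ss" if "x \<in> set E" for x
    using E that unfolding tileset_graph_def by auto
  {
    assume "has_geodesic_snake G ss E"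
    then obtain e :: "int \<Rightarrow> nat \<times> nat \<times> letter" where e: "\<And>i. e i \<in> set E"
      "\<And>i. fst (snd (e i)) = fst (e (i + 1))"
      and geo: "\<And>i j. i \<le> j \<Longrightarrow> geodesic G ss (map (\<lambda>k. snd (snd (e k))) [i..j])"
      unfolding has_geodesic_snake_iff by blast
    have "[0..int n] = map int [0..<Suc n]" for n
    proof (rule nth_equalityI)
      fix i assume "i < length [0..int n]"
      then have "i < Suc n" by simp
      then show "[0..int n] ! i = map int [0..<Suc n] ! i" by (simp del: upt_Suc)
    qed simp
    from this[of ?N] have "map (\<lambda>i. snd (snd (e (int i)))) [0..<Suc ?N] \<in> Geo G ss"
      using geo[of 0 "int ?N"] by (simp add: Geo_def comp_def del: upt_Suc)
    moreover have "map (\<lambda>i. snd (snd (e (int i)))) [0..<Suc ?N] \<in> lists (letters ss)"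
      unfolding lists_eq_set using e(1) edge_letter by (simp add: image_subset_iff del: upt_Suc)
    ultimately have "?path (\<lambda>i. e (int i))"
      using e acc by (simp add: add.commute del: upt_Suc)
    then show "\<exists>e. ?path e" by (rule exI[of ?path "\<lambda>i. e (int i)"])
  next
    assume "\<exists>e. ?path e"
    then obtain e where "?path e" ..
    then have e: "\<And>i. i \<le> ?N \<Longrightarrow> e i \<in> set E"
      "\<And>i. i < ?N \<Longrightarrow> fst (snd (e i)) = fst (e (Suc i))"
      and run: "fold (\<lambda>a q. \<delta> q a) (map (\<lambda>i. snd (snd (e i))) [0..<Suc ?N]) q0 \<in> F" by simp_all
    define w where "w i j = map (\<lambda>i. snd (snd (e i))) [i..<j]" for i j
    define st where "st i = fold (\<lambda>a q. \<delta> q a) (w 0 i) q0" for i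
    have w_letters: "w i j \<in> lists (letters ss)" if "j \<le> Suc ?N" for i j
      unfolding lists_eq_set using that e(1) edge_letter by (simp add: w_def image_subset_iff)
    have w_append: "w i k = w i j @ w j k" if "i \<le> j" "j \<le> k" for i j k
      using that upt_add_eq_append[of i j "k - j"] by (simp add: w_def)
    have fold_Q: "fold (\<lambda>a q. \<delta> q a) u q \<in> Q" if "u \<in> lists (letters ss)" "q \<in> Q" for u q
      using that by (induction u arbitrary: q) (auto simp: \<delta>)
    \<comment> \<open>\<open>st i\<close> is the state before edge \<open>i\<close> is read. There
      are \<open>?N + 1\<close> positions but at most \<open>?N\<close> pairs, since repeated list
      entries only lower the number of edges.\<close>
    have "(\<lambda>i. (e i, st i)) ` {..?N} \<subseteq> set E \<times> Q"
      using e(1) fold_Q w_letters Q unfolding st_def by auto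
    then have "card ((\<lambda>i. (e i, st i)) ` {..?N}) \<le> card (set E \<times> Q)"
      using Q by (intro card_mono) auto
    also have "\<dots> \<le> ?N" by (simp add: card_cartesian_product card_length)
    finally have "\<not> inj_on (\<lambda>i. (e i, st i)) {..?N}"
      by (intro pigeonhole) simp
    then obtain i j where ij: "i < j" "j \<le> ?N" "e i = e j" "st i = st j"
      unfolding inj_on_def by (metis Pair_inject atMost_iff linorder_neqE_nat)
    define p where "p = j - i"
    have p: "p > 0" "i + p = j" using ij by (auto simp: p_def)
    \<comment> \<open>The cycle unrolled with period \<open>p\<close>. The step from edge
      \<open>j - 1\<close> back to edge \<open>i\<close> is a link because
      \<open>e i = e j\<close>.\<close>
    define c where "c k = e (i + k mod p)" for k
    define v where "v = w i j"
    have v_letters: "v \<in> lists (letters ss)" using w_letters ij by (simp add: v_def)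
    have fold_v: "fold (\<lambda>a q. \<delta> q a) v (st i) = st i"
      using ij w_append[of 0 i j] by (simp add: st_def v_def)
    have fold_vn: "fold (\<lambda>a q. \<delta> q a) (concat (replicate n v)) (st i) = st i" for n
      using fold_v by (induction n) auto
    have geo_v: "geodesic G ss (concat (replicate n v))" for n
    proof -
      \<comment> \<open>\<open>v\<close> fixes the state \<open>st i\<close>, so any power of it may
        replace its single copy in the accepted word.\<close>
      let ?u = "w 0 i @ concat (replicate n v) @ w j (Suc ?N)"
      have "fold (\<lambda>a q. \<delta> q a) ?u q0 = fold (\<lambda>a q. \<delta> q a) (w 0 j @ w j (Suc ?N)) q0"
        using fold_vn ij by (simp add: st_def)
      also have "w 0 j @ w j (Suc ?N) = w 0 (Suc ?N)" using w_append[of 0 j "Suc ?N"] ij by simp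
      finally have "fold (\<lambda>a q. \<delta> q a) ?u q0 \<in> F" using run by (simp add: w_def del: upt_Suc)
      moreover have "?u \<in> lists (letters ss)" using w_letters v_letters ij by (auto simp del: in_lists_conv_set)
      ultimately have "geodesic G ss ?u" using acc by (simp add: Geo_def)
      then show ?thesis by (rule geodesic_factor)
    qed
    have v_eq: "v = map (\<lambda>k. snd (snd (c (m * p + k)))) [0..<p]" for m
      using p map_add_upt[of i p] by (auto simp: v_def w_def c_def intro!: nth_equalityI)
    have v_power: "concat (replicate n v) = map (\<lambda>k. snd (snd (c k))) [0..<n * p]" for n
    proof (induction n)
      case (Suc n)
      have "concat (replicate (Suc n) v) = concat (replicate n v) @ v"
        by (simp flip: replicate_append_same)
      also have "\<dots> = map (\<lambda>k. snd (snd (c k))) ([0..<n * p] @ map (\<lambda>k. n * p + k) [0..<p])"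
        using Suc v_eq[of n] by simp
      also have "[0..<n * p] @ map (\<lambda>k. n * p + k) [0..<p] = [0..<Suc n * p]"
        using map_add_upt[of "n * p" p] upt_add_eq_append[of 0 "n * p" p] by (simp add: add.commute)
      finally show ?case .
    qed simp
    have geo_c: "geodesic G ss (map (\<lambda>k. snd (snd (c k))) [a..<b])" for a b
    proof (cases "a \<le> b")
      case True
      \<comment> \<open>\<open>b\<close> copies of the nonempty cycle reach at least to position
        \<open>b\<close> and so cover the window.\<close>
      have "b \<le> b * p" using p by simp
      moreover have "[0..<m] = [0..<a] @ [a..<b] @ [b..<m]" if "b \<le> m" for m
      proof -
        have "a \<le> m" using True that by simp
        then show ?thesis
          using True that upt_add_eq_append[of 0 a "m - a"] upt_add_eq_append[of a b "m - b"] by simp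
      qed
      ultimately have "[0..<b * p] = [0..<a] @ [a..<b] @ [b..<b * p]" by blast
      then have "geodesic G ss (map (\<lambda>k. snd (snd (c k))) [0..<a] @ map (\<lambda>k. snd (snd (c k))) [a..<b] @
          map (\<lambda>k. snd (snd (c k))) [b..<b * p])"
        using geo_v[of b] v_power[of b] by simp
      then show ?thesis by (rule geodesic_factor)
    qed (simp add: geodesic_Nil)
    have c_edge: "c k \<in> set E" for k
      unfolding c_def by (rule e(1)) (use p ij mod_less_divisor[of p k] in linarith)
    have c_link: "fst (snd (c k)) = fst (c (Suc k))" for k
    proof (cases "Suc (k mod p) = p")
      case True
      then have "i + k mod p < ?N" "Suc (i + k mod p) = j" using p ij by auto
      then show ?thesis using e(2)[of "i + k mod p"] True ij by (simp add: c_def mod_Suc)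
    next
      case False
      then have "Suc (k mod p) < p" using mod_less_divisor[OF p(1), of k] by linarith
      then show ?thesis using e(2)[of "i + k mod p"] False ij p by (simp add: c_def mod_Suc)
    qed
    define z where "z k = c (nat (k mod int p))" for k
    \<comment> \<open>Adding periods moves negative indices into the range where the one-sided facts
      about \<open>c\<close> apply; \<bar>k\<bar> periods suffice for index \<open>k\<close>, as
      \<open>p\<close> is positive.\<close>
    have z_c: "z k = c (nat (k + m * int p))" if "k + m * int p \<ge> 0" for k m
    proof -
      have "int (nat (k + m * int p) mod p) = k mod int p"
        using that by (simp add: zmod_int)
      then have "nat (k mod int p) = nat (k + m * int p) mod p" by (metis nat_int)
      then show ?thesis by (simp add: z_def c_def)
    qed
    have bound: "k + \<bar>k\<bar> * int p \<ge> 0" for k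
    proof -
      have "\<bar>k\<bar> * 1 \<le> \<bar>k\<bar> * int p" using p by (intro mult_left_mono) auto
      then show ?thesis by linarith
    qed
    have "z k \<in> set E" for k using c_edge by (simp add: z_def)
    moreover have "fst (snd (z k)) = fst (z (k + 1))" for k
    proof -
      define x where "x = k + \<bar>k\<bar> * int p"
      have x: "x \<ge> 0" "k + 1 + \<bar>k\<bar> * int p = x + 1" using bound[of k] by (simp_all add: x_def)
      have "z k = c (nat x)" using z_c[of k "\<bar>k\<bar>"] x by (simp add: x_def)
      moreover have "z (k + 1) = c (Suc (nat x))"
        using z_c[of "k + 1" "\<bar>k\<bar>"] x by (simp only: Suc_nat_eq_nat_zadd1 add.commute[of 1])
      ultimately show ?thesis using c_link by simp
    qed
    moreover have "geodesic G ss (map (\<lambda>k. snd (snd (z k))) [a..b])" if "a \<le> b" for a b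
    proof -
      let ?s = "nat (a + \<bar>a\<bar> * int p)"
      have "map (\<lambda>k. snd (snd (z k))) [a..b] = map (\<lambda>k. snd (snd (c k))) [?s..<?s + nat (b - a + 1)]"
      proof (rule nth_equalityI)
        fix n assume "n < length (map (\<lambda>k. snd (snd (z k))) [a..b])"
        then have n: "a + int n \<le> b" "n < nat (b - a + 1)" by simp_all
        have "nat (a + int n + \<bar>a\<bar> * int p) = ?s + n" using bound[of a] by simp
        then have "z (a + int n) = c (?s + n)" using z_c[of "a + int n" "\<bar>a\<bar>"] bound[of a] by simp
        then show "map (\<lambda>k. snd (snd (z k))) [a..b] ! n =
            map (\<lambda>k. snd (snd (c k))) [?s..<?s + nat (b - a + 1)] ! n"
          using n nth_upto[OF n(1)] nth_upt[of ?s n "?s + nat (b - a + 1)"] by simp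
      qed simp
      then show ?thesis using geo_c by simp
    qed
    ultimately show "has_geodesic_snake G ss E"
      unfolding has_geodesic_snake_iff by blast
  }
qed

text \<open>\<open>card Q\<close> does not depend on the tileset, so it is a constant of the
  program, and the path length to be searched is computable from the encoded edges alone.\<close>

lemma regular_Geo_imp_decidable:
  assumes "regular_lang (letters ss) (Geo G ss)"
  shows "geodesic_snake_decidable G ss"
proof -
  obtain Q :: "nat set" and q0 \<delta> F where A: "finite Q" "q0 \<in> Q" "F \<subseteq> Q"
    "\<forall>q\<in>Q. \<forall>a\<in>letters ss. \<delta> q a \<in> Q"
    "\<forall>w\<in>lists (letters ss). w \<in> Geo G ss \<longleftrightarrow> fold (\<lambda>a q. \<delta> q a) w q0 \<in> F"
    using assms unfolding regular_lang_def by (elim conjE exE) (rule that, assumption+)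
  from automaton_path_decidable[where \<delta> = \<delta> and ss = ss and k = "card Q", OF A(1-4)]
  show ?thesis unfolding geodesic_snake_decidable_def
  proof (elim exE, intro exI allI impI)
    fix f E assume f: "\<forall>E. tileset_graph ss E \<longrightarrow> eval_rf f [encode_tileset E]
      (of_bool (\<exists>e. (\<forall>i\<le>length E * card Q. e i \<in> set E) \<and>
        (\<forall>i<length E * card Q. fst (snd (e i)) = fst (e (Suc i))) \<and>
        fold (\<lambda>a q. \<delta> q a) (map (\<lambda>i. snd (snd (e i))) [0..<Suc (length E * card Q)]) q0 \<in> F))"
      and E: "tileset_graph ss E"
    show "eval_rf f [encode_tileset E] (if has_geodesic_snake G ss E then 1 else 0)"
      using f[rule_format, OF E]
      unfolding has_geodesic_snake_iff_long_path[where \<delta> = \<delta>, OF A E, symmetric] of_bool_def .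
  qed
qed

end

section \<open>Abelian groups\<close>

text \<open>Myhill-Nerode: \<open>\<phi>\<close> determines the residual of a word, so there are
  finitely many residuals. These serve as states rather than the values of \<open>\<phi>\<close>,
  whose equality need not persist after appending a letter.\<close>

lemma regular_lang_if_finite_index:
  assumes L: "L \<subseteq> lists \<Sigma>" and fin: "finite (\<phi> ` lists \<Sigma>)"
    and \<phi>: "\<And>u v w. u \<in> lists \<Sigma> \<Longrightarrow> v \<in> lists \<Sigma> \<Longrightarrow> w \<in> lists \<Sigma> \<Longrightarrow> \<phi> u = \<phi> v \<Longrightarrow>
      u @ w \<in> L \<longleftrightarrow> v @ w \<in> L"
  shows "regular_lang \<Sigma> L"
proof -
  define res where "res u = {w \<in> lists \<Sigma>. u @ w \<in> L}" for u
  let ?R = "res ` lists \<Sigma>"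
  have "res u = res (inv_into (lists \<Sigma>) \<phi> (\<phi> u))" if "u \<in> lists \<Sigma>" for u
    using \<phi>[of u "inv_into (lists \<Sigma>) \<phi> (\<phi> u)"] that
    by (auto simp: res_def f_inv_into_f inv_into_into)
  then have "?R \<subseteq> (\<lambda>c. res (inv_into (lists \<Sigma>) \<phi> c)) ` \<phi> ` lists \<Sigma>" by blast
  then have finR: "finite ?R" using fin by (meson finite_imageI finite_subset)
  then obtain enc :: "'a list set \<Rightarrow> nat" where enc: "inj_on enc ?R"
    using finite_imp_inj_to_nat_seg by blast
  \<comment> \<open>The left quotient of a residual by \<open>a\<close>, encoded because
    \<open>regular_lang\<close> asks for states that are natural numbers.\<close>
  define \<delta> where "\<delta> q a = enc {w \<in> lists \<Sigma>. a # w \<in> inv_into ?R enc q}" for q a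
  have \<delta>: "\<delta> (enc (res u)) a = enc (res (u @ [a]))" if "u \<in> lists \<Sigma>" "a \<in> \<Sigma>" for u a
  proof -
    have "inv_into ?R enc (enc (res u)) = res u" using that by (intro inv_into_f_f enc) auto
    moreover have "{w \<in> lists \<Sigma>. a # w \<in> res u} = res (u @ [a])" using that by (auto simp: res_def)
    ultimately show ?thesis by (simp add: \<delta>_def)
  qed
  have run: "fold (\<lambda>a q. \<delta> q a) w (enc (res [])) = enc (res w)" if "w \<in> lists \<Sigma>" for w
    using that by (induction w rule: rev_induct) (auto simp: \<delta>)
  have acc: "w \<in> L \<longleftrightarrow> enc (res w) \<in> enc ` {r \<in> ?R. [] \<in> r}" if "w \<in> lists \<Sigma>" for w
  proof -
    have "res w \<in> ?R" using that by (rule imageI)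
    then have "enc (res w) \<in> enc ` {r \<in> ?R. [] \<in> r} \<longleftrightarrow> res w \<in> {r \<in> ?R. [] \<in> r}"
      by (intro inj_on_image_mem_iff[OF enc]) blast+
    then show ?thesis using \<open>res w \<in> ?R\<close> by (simp add: res_def)
  qed
  show ?thesis
    unfolding regular_lang_def
  proof (intro conjI L exI)
    show "finite (enc ` ?R)" using finR by simp
    show "enc (res []) \<in> enc ` ?R" by auto
    show "\<forall>q\<in>enc ` ?R. \<forall>a\<in>\<Sigma>. \<delta> q a \<in> enc ` ?R"
    proof (intro ballI)
      fix q a assume "q \<in> enc ` ?R" "a \<in> \<Sigma>"
      then obtain u where u: "u \<in> lists \<Sigma>" "q = enc (res u)" by blast
      then have "u @ [a] \<in> lists \<Sigma>" using \<open>a \<in> \<Sigma>\<close> by simp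
      then show "\<delta> q a \<in> enc ` ?R" using \<delta>[OF u(1) \<open>a \<in> \<Sigma>\<close>] u(2) by blast
    qed
    show "enc ` {r \<in> ?R. [] \<in> r} \<subseteq> enc ` ?R" by blast
    show "\<forall>w\<in>lists \<Sigma>. w \<in> L \<longleftrightarrow> fold (\<lambda>a q. \<delta> q a) w (enc (res [])) \<in> enc ` {r \<in> ?R. [] \<in> r}"
      using run acc by simp
  qed
qed

section \<open>Dickson's lemma through nondecreasing subsequences\<close>

lemma nat_seq_incseq_subseq:
  fixes f :: "nat \<Rightarrow> nat"
  shows "\<exists>r. strict_mono r \<and> incseq (\<lambda>n. f (r n))"
proof -
  obtain r :: "nat \<Rightarrow> nat" where r: "strict_mono r" "monoseq (\<lambda>n. f (r n))"
    using seq_monosub[of f] by blast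
  show ?thesis
  proof (cases "incseq (\<lambda>n. f (r n))")
    case False
    then have dec: "decseq (\<lambda>n. f (r n))" using r(2) by (simp add: monoseq_iff)
    \<comment> \<open>A decreasing sequence of natural numbers is constant once it has attained its
      minimum.\<close>
    obtain m where m: "\<And>n. f (r m) \<le> f (r n)"
      using ex_has_least_nat[of "\<lambda>_. True" 0 "\<lambda>n. f (r n)"] by auto
    have "f (r (m + n)) = f (r m)" for n
      using m[of "m + n"] decseqD[OF dec, of m "m + n"] by simp
    then have "incseq (\<lambda>n. f (r (m + n)))" by (simp add: incseq_def)
    moreover have "strict_mono (\<lambda>n. r (m + n))" using r(1) by (simp add: strict_mono_def)
    ultimately show ?thesis by blast
  qed (use r in blast)
qed

text \<open>One coordinate at a time: further thinning keeps the coordinates already treated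
  nondecreasing.\<close>

lemma Dickson_incseq_subseq:
  fixes f :: "nat \<Rightarrow> 'c \<Rightarrow> nat"
  assumes "finite A"
  shows "\<exists>r. strict_mono r \<and> (\<forall>a\<in>A. incseq (\<lambda>n. f (r n) a))"
  using assms
proof (induction A)
  case empty
  then show ?case using strict_mono_id by blast
next
  case (insert b A)
  then obtain r where r: "strict_mono r" "\<forall>a\<in>A. incseq (\<lambda>n. f (r n) a)" by blast
  obtain s where s: "strict_mono s" "incseq (\<lambda>n. f (r (s n)) b)"
    using nat_seq_incseq_subseq[of "\<lambda>n. f (r n) b"] by blast
  have "incseq (\<lambda>n. f (r (s n)) a)" if "a \<in> A" for a
    using r(2) that s(1) by (simp add: incseq_def strict_mono_less_eq)
  moreover have "strict_mono (r \<circ> s)" using r(1) s(1) by (rule strict_mono_o)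
  ultimately show ?case using s(2) by (intro exI[of _ "r \<circ> s"]) (simp add: comp_def)
qed

text \<open>Without a finite basis one could forever choose elements that dominate no earlier one,
  which a subsequence nondecreasing in all coordinates contradicts.\<close>

lemma Dickson_finite_basis:
  fixes N :: "('c \<Rightarrow> nat) set"
  assumes "finite A"
  shows "\<exists>M\<subseteq>N. finite M \<and> (\<forall>x\<in>N. \<exists>m\<in>M. \<forall>a\<in>A. m a \<le> x a)"
proof (rule ccontr)
  assume no: "\<not> ?thesis"
  have "\<exists>f. \<forall>n::nat. f n \<in> N \<and> (\<forall>i<n. \<not> (\<forall>a\<in>A. f i a \<le> f n a))"
  proof (rule dependent_wellorder_choice)
    fix n :: nat and f assume f: "\<And>k. k < n \<Longrightarrow> f k \<in> N \<and> (\<forall>i<k. \<not> (\<forall>a\<in>A. f i a \<le> f k a))"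
    have "f ` {..<n} \<subseteq> N" "finite (f ` {..<n})" using f by auto
    then obtain x where "x \<in> N" "\<forall>m\<in>f ` {..<n}. \<not> (\<forall>a\<in>A. m a \<le> x a)" using no by metis
    then show "\<exists>x. x \<in> N \<and> (\<forall>i<n. \<not> (\<forall>a\<in>A. f i a \<le> x a))" by auto
  qed simp
  then obtain f :: "nat \<Rightarrow> 'c \<Rightarrow> nat" where f: "\<And>i n. i < n \<Longrightarrow> \<not> (\<forall>a\<in>A. f i a \<le> f n a)" by blast
  obtain r :: "nat \<Rightarrow> nat" where r: "strict_mono r" "\<forall>a\<in>A. incseq (\<lambda>n. f (r n) a)"
    using Dickson_incseq_subseq[OF assms, of f] by blast
  have "r 0 < r 1" using r(1) by (simp add: strict_mono_def)
  moreover have "\<forall>a\<in>A. f (r 0) a \<le> f (r 1) a" using r(2) by (simp add: incseq_def)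
  ultimately show False using f by blast
qed

context generated_group
begin

lemma word_val_mset_cong:
  assumes "comm_group G" "u \<in> lists (letters ss)" "mset u = mset v"
  shows "word_val G ss u = word_val G ss v"
  using assms(2,3)
proof (induction u arbitrary: v rule: list.induct)
  case (Cons l u)
  interpret comm_group G by fact
  have "l \<in> set v" using Cons.prems(2) by (metis list.set_intros(1) mset_eq_setD)
  then obtain v1 v2 where v: "v = v1 @ l # v2" by (meson split_list)
  then have "mset u = mset (v1 @ v2)" using Cons.prems(2) by simp
  then have IH: "word_val G ss u = word_val G ss (v1 @ v2)" using Cons by simp
  have "set v = set (l # u)" using Cons.prems(2) by (metis mset_eq_setD)
  then have "v \<in> lists (letters ss)" using Cons.prems(1) by (auto simp: in_lists_conv_set)
  then have vl: "v1 \<in> lists (letters ss)" "v2 \<in> lists (letters ss)" "l \<in> letters ss" using v by auto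
  then show ?case
    by (simp add: IH v word_val_Cons word_val_append word_val_closed letter_val_closed m_lcomm)
qed simp

text \<open>By commutativity \<open>v\<close> represents the same element as \<open>u @ r\<close>
  for the leftover letters \<open>r\<close>, so a shorter word for \<open>u\<close> gives a shorter
  one for \<open>v\<close>.\<close>

lemma not_geodesic_dominating:
  assumes "comm_group G" "u \<in> lists (letters ss)" "v \<in> lists (letters ss)" "\<not> geodesic G ss u"
    and le: "\<forall>l\<in>letters ss. count (mset u) l \<le> count (mset v) l"
  shows "\<not> geodesic G ss v"
proof -
  have "mset u \<subseteq># mset v"
    using le assms(2) by (auto simp: subseteq_mset_def in_lists_conv_set) (metis count_mset_0_iff le0)
  then obtain r where r: "mset v = mset u + mset r"
    by (metis ex_mset subset_mset.add_diff_inverse)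
  have "set r \<subseteq> set v" using r by (metis set_mset_mset set_mset_union Un_upper2)
  then have rl: "r \<in> lists (letters ss)" using assms(3) by (auto simp: in_lists_conv_set)
  obtain x where x: "x \<in> lists (letters ss)" "word_val G ss x = word_val G ss u" "length x < length u"
    using assms(2,4) unfolding geodesic_def by (auto simp: not_le)
  have "word_val G ss v = word_val G ss (u @ r)"
    using word_val_mset_cong[OF assms(1,3), of "u @ r"] r by simp
  also have "\<dots> = word_val G ss (x @ r)" using x rl assms(2) by (simp add: word_val_append)
  finally have "word_val G ss (x @ r) = word_val G ss v" by simp
  moreover have "length v = length u + length r" using r by (metis size_mset size_union)
  moreover have "x @ r \<in> lists (letters ss)" using x rl by simp
  ultimately have "x @ r \<in> lists (letters ss) \<and> word_val G ss (x @ r) = word_val G ss v \<and> \<not> length v \<le> length (x @ r)"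
    using x(3) by simp
  then show ?thesis unfolding geodesic_def by blast
qed

text \<open>Being non-geodesic only depends on the letter counts and is upward closed in them, so by
  Dickson's lemma it is witnessed by counts truncated at a fixed bound.\<close>

lemma regular_Geo_abelian:
  assumes "comm_group G"
  shows "regular_lang (letters ss) (Geo G ss)"
proof -
  let ?\<Sigma> = "letters ss"
  let ?N = "{count (mset w) |w. w \<in> lists ?\<Sigma> \<and> \<not> geodesic G ss w}"
  obtain M where M: "M \<subseteq> ?N" "finite M" "\<forall>x\<in>?N. \<exists>m\<in>M. \<forall>l\<in>?\<Sigma>. m l \<le> x l"
    using Dickson_finite_basis[OF finite_letters[of ss], of ?N] by (elim exE conjE) (rule that)
  \<comment> \<open>\<open>B\<close> bounds all entries of the finite basis on the alphabet, so
    comparing a count with such an entry only sees the count up to \<open>B\<close>.\<close>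
  have "finite (\<Union>m\<in>M. m ` ?\<Sigma>)" using M(2) finite_letters by blast
  then obtain B where "\<forall>k\<in>(\<Union>m\<in>M. m ` ?\<Sigma>). k \<le> B"
    unfolding finite_nat_set_iff_bounded_le ..
  then have B: "m l \<le> B" if "m \<in> M" "l \<in> ?\<Sigma>" for m l using that by blast
  have geo_iff: "w \<in> Geo G ss \<longleftrightarrow> \<not> (\<exists>m\<in>M. \<forall>l\<in>?\<Sigma>. m l \<le> count (mset w) l)"
    if w: "w \<in> lists ?\<Sigma>" for w
  proof -
    have "\<not> geodesic G ss w" if m: "m \<in> M" "\<forall>l\<in>?\<Sigma>. m l \<le> count (mset w) l" for m
    proof -
      obtain u where "m = count (mset u)" "u \<in> lists ?\<Sigma>" "\<not> geodesic G ss u" using M(1) m(1) by blast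
      then show ?thesis using not_geodesic_dominating[OF assms _ w] m(2) by blast
    qed
    moreover have "\<exists>m\<in>M. \<forall>l\<in>?\<Sigma>. m l \<le> count (mset w) l" if "\<not> geodesic G ss w"
      using M(3) w that by blast
    ultimately show ?thesis unfolding Geo_def by blast
  qed
  define \<phi> where "\<phi> w = (\<lambda>l. if l \<in> ?\<Sigma> then min (count (mset w) l) B else 0)" for w
  show ?thesis
  proof (rule regular_lang_if_finite_index)
    show "Geo G ss \<subseteq> lists ?\<Sigma>" by (auto simp: Geo_def geodesic_def)
    have "\<phi> ` lists ?\<Sigma> \<subseteq> {f. \<forall>l. (l \<in> ?\<Sigma> \<longrightarrow> f l \<in> {..B}) \<and> (l \<notin> ?\<Sigma> \<longrightarrow> f l = 0)}"
      by (auto simp: \<phi>_def)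
    moreover have "finite {f. \<forall>l. (l \<in> ?\<Sigma> \<longrightarrow> f l \<in> {..B}) \<and> (l \<notin> ?\<Sigma> \<longrightarrow> f l = 0)}"
      by (intro finite_set_of_finite_funs finite_letters) simp
    ultimately show "finite (\<phi> ` lists ?\<Sigma>)" by (rule finite_subset)
    fix u v w assume uvw: "u \<in> lists ?\<Sigma>" "v \<in> lists ?\<Sigma>" "w \<in> lists ?\<Sigma>" "\<phi> u = \<phi> v"
    \<comment> \<open>Two counts that are equal or both at least \<open>B\<close> remain so after
      adding the count of \<open>w\<close>.\<close>
    have "m l \<le> count (mset (u @ w)) l \<longleftrightarrow> m l \<le> count (mset (v @ w)) l" if "m \<in> M" "l \<in> ?\<Sigma>" for m l
    proof -
      have "min (count (mset u) l) B = min (count (mset v) l) B"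
        using fun_cong[OF uvw(4), of l] that(2) by (simp add: \<phi>_def)
      then show ?thesis using B[OF that] by (auto simp: min_def split: if_splits)
    qed
    moreover have "u @ w \<in> lists ?\<Sigma>" "v @ w \<in> lists ?\<Sigma>" using uvw by auto
    ultimately show "u @ w \<in> Geo G ss \<longleftrightarrow> v @ w \<in> Geo G ss"
      by (simp only: geo_iff) blast
  qed
qed

end

section \<open>Stability of quasi-geodesics\<close>

definition gprod :: "('a \<Rightarrow> 'a \<Rightarrow> nat) \<Rightarrow> 'a \<Rightarrow> 'a \<Rightarrow> 'a \<Rightarrow> real" where
  "gprod d w x y = (real (d w x) + real (d w y) - real (d x y)) / 2"

lemma linear_below_power2:
  fixes A B :: real
  shows "\<exists>k0. \<forall>k\<ge>k0. A + B * real k < 2 ^ k"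
proof -
  have "(\<lambda>k. A / 2 ^ k + B * (real k / 2 ^ k)) \<longlonglongrightarrow> 0 + B * 0"
    using lim_n_over_pown[of "2::real"]
    by (intro tendsto_add tendsto_mult tendsto_const LIMSEQ_divide_realpow_zero) auto
  then have "eventually (\<lambda>k. A / 2 ^ k + B * (real k / 2 ^ k) < 1) sequentially"
    by (intro order_tendstoD(2)[of _ 0]) auto
  then obtain k0 where k0: "\<forall>k\<ge>k0. A / 2 ^ k + B * (real k / 2 ^ k) < 1"
    unfolding eventually_sequentially by blast
  have "A + B * real k < 2 ^ k" if "k \<ge> k0" for k
  proof -
    have "(A + B * real k) / 2 ^ k < 1" using k0 that by (simp add: add_divide_distrib)
    then show ?thesis by (simp add: divide_less_eq)
  qed
  then show ?thesis by blast
qed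

text \<open>\<open>k\<close> is about the binary logarithm of \<open>L * D\<close>. It measures the
  loss along a detour of \<open>L * D\<close> steps, which for large \<open>D\<close> cannot compete
  with \<open>D\<close> itself.\<close>

lemma logarithm_below_linear:
  fixes L :: nat and A B :: real
  assumes "B \<ge> 0"
  shows "\<exists>D0. \<forall>D>D0. \<exists>k. L * D \<le> 2 ^ k \<and> A + B * real k < real D"
proof -
  obtain k0 where k0: "\<forall>k\<ge>k0. 2 * real L * A + 2 * real L * B * real k < 2 ^ k"
    using linear_below_power2 by blast
  obtain D0 :: nat where D0: "A + B * real k0 < real D0" using reals_Archimedean2 by blast
  have "\<exists>k. L * D \<le> 2 ^ k \<and> A + B * real k < real D" if "D > D0" for D
  proof -
    define k where "k = (LEAST k. L * D \<le> 2 ^ k)"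
    have k: "L * D \<le> 2 ^ k" unfolding k_def
      by (rule LeastI[of _ "L * D"]) (simp add: less_imp_le)
    show ?thesis
    proof (cases "k \<le> k0")
      case True
      then have "B * real k \<le> B * real k0" using assms by (intro mult_left_mono) auto
      then show ?thesis using D0 that k by (intro exI[of _ k]) auto
    next
      case False
      then obtain j where j: "k = Suc j" by (cases k) auto
      then have "\<not> L * D \<le> 2 ^ j" using not_less_Least[of j "\<lambda>k. L * D \<le> 2 ^ k"] by (simp add: k_def)
      then have "2 ^ k < 2 * (L * D)" using j by simp
      then have "real (2 ^ k) < real (2 * (L * D))" by (simp only: of_nat_less_iff)
      then have less: "2 ^ k < 2 * real L * real D" by simp
      have "2 * real L * (A + B * real k) < 2 ^ k" using k0[rule_format, of k] False by (simp add: algebra_simps)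
      then have "2 * real L * (A + B * real k) < 2 * real L * real D" using less by linarith
      then have "A + B * real k < real D" by (rule mult_left_less_imp_less) simp
      then show ?thesis using k by blast
    qed
  qed
  then show ?thesis by blast
qed

text \<open>The model is the vertex set of a Cayley graph: distances are natural numbers, and
  \<open>geod\<close> supplies points at every integer distance in place of continuous
  geodesics.\<close>

locale hyperbolic_metric =
  fixes X :: "'a set" and d :: "'a \<Rightarrow> 'a \<Rightarrow> nat" and \<delta> :: real
  assumes refl: "x \<in> X \<Longrightarrow> d x x = 0"
    and sym: "x \<in> X \<Longrightarrow> y \<in> X \<Longrightarrow> d x y = d y x"
    and tri: "x \<in> X \<Longrightarrow> y \<in> X \<Longrightarrow> z \<in> X \<Longrightarrow> d x z \<le> d x y + d y z"
    and geod: "x \<in> X \<Longrightarrow> y \<in> X \<Longrightarrow> k \<le> d x y \<Longrightarrow> \<exists>z\<in>X. d x z = k \<and> d z y = d x y - k"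
    and \<delta>: "\<delta> \<ge> 0"
    and hyp: "w \<in> X \<Longrightarrow> x \<in> X \<Longrightarrow> y \<in> X \<Longrightarrow> z \<in> X \<Longrightarrow>
      min (gprod d w x z) (gprod d w z y) - \<delta> \<le> gprod d w x y"
begin

section \<open>Gromov products along chains and paths\<close>

lemma gprod_sym: "x \<in> X \<Longrightarrow> y \<in> X \<Longrightarrow> gprod d w x y = gprod d w y x"
  by (simp add: gprod_def sym[of x y])

lemma gprod_self: "x \<in> X \<Longrightarrow> gprod d w x x = d w x"
  by (simp add: gprod_def refl)

text \<open>Bisecting the chain costs one \<open>\<delta>\<close> per halving, so the loss grows
  with the logarithm of the number of links instead of the number itself.\<close>

lemma gprod_chain:
  assumes "w \<in> X" "\<And>i. i \<le> n \<Longrightarrow> x i \<in> X" "\<And>i. i < n \<Longrightarrow> m \<le> gprod d w (x i) (x (Suc i))"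
    and "1 \<le> n" "n \<le> 2 ^ k"
  shows "m - real k * \<delta> \<le> gprod d w (x 0) (x n)"
  using assms(2-)
proof (induction k arbitrary: x n)
  case 0
  then have "n = 1" by simp
  then show ?case using 0(2)[of 0] by simp
next
  case (Suc k)
  show ?case
  proof (cases "n \<le> 2 ^ k")
    case True
    then have "m - real k * \<delta> \<le> gprod d w (x 0) (x n)" using Suc.prems by (intro Suc.IH) auto
    then show ?thesis using \<delta> by (simp add: algebra_simps)
  next
    case False
    let ?h = "2 ^ k :: nat"
    have "m - real k * \<delta> \<le> gprod d w (x 0) (x ?h)"
      using Suc.prems False by (intro Suc.IH) auto
    moreover have "m - real k * \<delta> \<le> gprod d w (x (?h + 0)) (x (?h + (n - ?h)))"
      using Suc.prems False by (intro Suc.IH[of "n - ?h" "\<lambda>i. x (?h + i)"]) auto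
    moreover have "min (gprod d w (x 0) (x ?h)) (gprod d w (x ?h) (x n)) - \<delta> \<le> gprod d w (x 0) (x n)"
      using Suc.prems False assms(1) by (intro hyp) auto
    ultimately show ?thesis using False by (simp add: algebra_simps)
  qed
qed

text \<open>Two points at distance at least \<open>D\<close> from \<open>w\<close> and at most
  \<open>\<kappa>\<close> from each other have Gromov product at least
  \<open>D - \<kappa> / 2\<close>; chaining does the rest.\<close>

lemma gprod_path:
  assumes w: "w \<in> X" and x: "\<And>i. i \<le> n \<Longrightarrow> x i \<in> X" and s: "\<And>i. i < n \<Longrightarrow> d (x i) (x (Suc i)) \<le> \<kappa>"
    and D: "\<And>i. i \<le> n \<Longrightarrow> D \<le> d w (x i)" and n: "n \<le> 2 ^ k"
  shows "real D - real \<kappa> / 2 - real k * \<delta> \<le> gprod d w (x 0) (x n)"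
proof (cases "n = 0")
  case True
  have "0 \<le> real k * \<delta>" using \<delta> by simp
  moreover have "real D \<le> real (d w (x 0))" using D[of 0] by simp
  ultimately show ?thesis using True x by (simp add: gprod_self)
next
  case False
  have "real D - real \<kappa> / 2 \<le> gprod d w (x i) (x (Suc i))" if "i < n" for i
  proof -
    have "real (d (x i) (x (Suc i))) \<le> real \<kappa>" "real D \<le> real (d w (x i))" "real D \<le> real (d w (x (Suc i)))"
      using s[of i] D[of i] D[of "Suc i"] that by simp_all
    then show ?thesis by (simp add: gprod_def field_simps)
  qed
  then show ?thesis using False by (intro gprod_chain[OF w x _ _ n]) auto
qed

text \<open>There is no additive error term: prefixes of a geodesic word, measured in another word
  metric, satisfy both multiplicative bounds exactly.\<close>

definition quasi_geodesic :: "nat \<Rightarrow> (nat \<Rightarrow> 'a) \<Rightarrow> nat \<Rightarrow> bool" where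
  "quasi_geodesic \<kappa> c n \<longleftrightarrow> (\<forall>i\<le>n. c i \<in> X) \<and>
    (\<forall>j\<le>n. \<forall>i\<le>j. d (c i) (c j) \<le> \<kappa> * (j - i) \<and> j - i \<le> \<kappa> * d (c i) (c j))"

text \<open>If \<open>z\<^sub>0\<close> is a point of the geodesic at maximal distance \<open>D\<close> from the quasi-geodesic, then points
  \<open>y\<close>, \<open>y'\<close> of the geodesic at distance \<open>2D\<close> on both sides of \<open>z\<^sub>0\<close> are joined by a detour through the
  quasi-geodesic of length linear in \<open>D\<close> that avoids the \<open>D\<close>-ball around \<open>z\<^sub>0\<close>. Chaining Gromov
  products along the detour costs only \<open>\<delta> log D\<close>, whereas \<open>(y|y') = 0\<close> at \<open>z\<^sub>0\<close>.\<close>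

lemma geodesic_near_quasi_geodesic:
  "\<exists>D0. \<forall>c n z. quasi_geodesic \<kappa> c n \<longrightarrow> z \<in> X \<longrightarrow> d (c 0) z + d z (c n) = d (c 0) (c n) \<longrightarrow>
    (\<exists>t\<le>n. d z (c t) \<le> D0)"
proof -
  \<comment> \<open>The detour points \<open>c s\<close> and \<open>c s'\<close> will be at distance
    at most \<open>D + 4 * D + D\<close>, hence at most \<open>6 * \<kappa> * D\<close> steps apart.
    The loss of a single step is \<open>\<kappa> / 2\<close>, and \<open>2 * \<delta>\<close> pays
    for attaching \<open>y\<close> and \<open>y'\<close>.\<close>
  obtain D0 where D0: "\<forall>D>D0. \<exists>k. (6 * \<kappa>) * D \<le> 2 ^ k \<and> (real \<kappa> / 2 + 2 * \<delta>) + \<delta> * real k < real D"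
    using logarithm_below_linear[OF \<delta>] by blast
  have "\<exists>t\<le>n. d z (c t) \<le> D0"
    if qg: "quasi_geodesic \<kappa> c n" and z: "z \<in> X" "d (c 0) z + d z (c n) = d (c 0) (c n)" for c n z
  proof (rule ccontr)
    assume far: "\<not> (\<exists>t\<le>n. d z (c t) \<le> D0)"
    have cX: "\<And>i. i \<le> n \<Longrightarrow> c i \<in> X" using qg by (simp add: quasi_geodesic_def)
    \<comment> \<open>All geodesics between the endpoints are treated together, so the maximality of
      \<open>D\<close> also applies to \<open>y\<close> and \<open>y'\<close>, which need not lie on
      a geodesic fixed beforehand.\<close>
    define btw where "btw y \<longleftrightarrow> y \<in> X \<and> d (c 0) y + d y (c n) = d (c 0) (c n)" for y
    define S where "S m \<longleftrightarrow> (\<exists>y. btw y \<and> (\<forall>t\<le>n. m \<le> d y (c t)))" for m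
    have "S (Suc D0)" using far z unfolding S_def btw_def by (intro exI[of _ z]) auto
    have S_le: "m \<le> d (c 0) (c n)" if "S m" for m
      using that sym cX[of 0] unfolding S_def btw_def by (metis le0 le_add1 order_trans)
    define D where "D = (GREATEST m. S m)"
    have "S D" unfolding D_def using \<open>S (Suc D0)\<close> S_le by (rule GreatestI_nat)
    then obtain z0 where z0: "btw z0" "\<And>t. t \<le> n \<Longrightarrow> D \<le> d z0 (c t)" unfolding S_def by blast
    have "D > D0" using Greatest_le_nat[of S, OF \<open>S (Suc D0)\<close> S_le] by (simp add: D_def)
    have "\<not> S (Suc D)" using Greatest_le_nat[of S "Suc D", OF _ S_le] by (auto simp: D_def)
    then have near: "\<exists>t\<le>n. d y (c t) \<le> D" if "btw y" for y
      using that unfolding S_def by (auto simp: not_less_eq_eq)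
    have z0X: "z0 \<in> X" and z0b: "d (c 0) z0 + d z0 (c n) = d (c 0) (c n)"
      using z0(1) by (auto simp: btw_def)
    \<comment> \<open>If the endpoint \<open>e\<close> is within \<open>2 * D\<close> of
      \<open>z0\<close>, it serves as \<open>y\<close> and as its own neighbour. Otherwise
      \<open>y\<close> is at distance exactly \<open>2 * D\<close>, and its product with
      \<open>c s\<close> is at least \<open>(2 * D + D - D) / 2\<close>.\<close>
    have side: "\<exists>y\<in>X. \<exists>s\<le>n. d e y + d y z0 = d e z0 \<and> d y (c s) \<le> D \<and> D \<le> gprod d z0 y (c s) \<and> d y z0 \<le> 2 * D"
      if e: "e = c s0" "s0 \<le> n" and b: "\<And>y. y \<in> X \<Longrightarrow> d e y + d y z0 = d e z0 \<Longrightarrow> btw y" for e s0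
    proof (cases "d e z0 \<le> 2 * D")
      case True
      have "D \<le> gprod d z0 e e" using z0(2)[of s0] e cX by (simp add: gprod_self)
      then show ?thesis using True e cX[of s0] refl[of "c s0"]
        by (intro bexI[of _ e] exI[of _ s0]) auto
    next
      case False
      have eX: "e \<in> X" using e cX by simp
      obtain y where y: "y \<in> X" "d e y = d e z0 - 2 * D" "d y z0 = d e z0 - (d e z0 - 2 * D)"
        using geod[OF eX z0X, of "d e z0 - 2 * D"] by auto
      then have y2: "d y z0 = 2 * D" "d e y + d y z0 = d e z0" using False by auto
      obtain s where s: "s \<le> n" "d y (c s) \<le> D" using near[OF b[OF y(1) y2(2)]] by blast
      have "real D \<le> gprod d z0 y (c s)"
        using s z0(2)[OF s(1)] y2 sym[OF y(1) z0X] by (simp add: gprod_def)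
      then show ?thesis using y y2 s by (intro bexI[of _ y] exI[of _ s]) auto
    qed
    have "btw y" if y: "y \<in> X" "d (c 0) y + d y z0 = d (c 0) z0" for y
    proof -
      have "d y (c n) \<le> d y z0 + d z0 (c n)" "d (c 0) (c n) \<le> d (c 0) y + d y (c n)"
        using tri y z0X cX by auto
      then show ?thesis using y z0b unfolding btw_def by auto
    qed
    from side[OF HOL.refl le0 this] obtain y s where y: "y \<in> X" "s \<le> n" "d (c 0) y + d y z0 = d (c 0) z0"
      "d y (c s) \<le> D" "D \<le> gprod d z0 y (c s)" "d y z0 \<le> 2 * D" by blast
    have "btw y" if y: "y \<in> X" "d (c n) y + d y z0 = d (c n) z0" for y
    proof -
      have "d (c 0) y \<le> d (c 0) z0 + d z0 y" "d (c 0) (c n) \<le> d (c 0) y + d y (c n)"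
        using tri y z0X cX by auto
      then show ?thesis using y z0b sym[of y z0] sym[of "c n" y] sym[of "c n" z0] cX[of n] z0X
        unfolding btw_def by auto
    qed
    from side[OF HOL.refl order.refl this] obtain y' s' where y': "y' \<in> X" "s' \<le> n"
      "d (c n) y' + d y' z0 = d (c n) z0" "d y' (c s') \<le> D" "D \<le> gprod d z0 y' (c s')" "d y' z0 \<le> 2 * D" by blast
    have syms: "d y' (c n) = d (c n) y'" "d z0 y' = d y' z0" "d z0 (c n) = d (c n) z0" "d z0 y = d y z0"
      "d (c s) y = d y (c s)"
      using sym y y' z0X cX by auto
    have "d (c 0) (c n) \<le> d (c 0) y + d y y' + d y' (c n)"
      using tri[of "c 0" y "c n"] tri[of y y' "c n"] y(1) y'(1) cX by fastforce
    \<comment> \<open>\<open>y\<close> and \<open>y'\<close> lie on opposite sides of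
      \<open>z0\<close>; a shortcut between them would shorten the geodesic.\<close>
    then have "d y z0 + d y' z0 \<le> d y y'" using y(3) y'(3) z0b syms by linarith
    then have opp: "gprod d z0 y y' \<le> 0" using syms by (simp add: gprod_def)
    obtain k where k: "(6 * \<kappa>) * D \<le> 2 ^ k" "(real \<kappa> / 2 + 2 * \<delta>) + \<delta> * real k < real D"
      using D0 \<open>D > D0\<close> by blast
    have "d y y' \<le> 4 * D" using tri[of y z0 y'] y y' syms z0X by fastforce
    moreover have "d (c s) (c s') \<le> d (c s) y + (d y y' + d y' (c s'))"
      using tri[of "c s" y "c s'"] tri[of y y' "c s'"] y y' cX by fastforce
    ultimately have "d (c s) (c s') \<le> 6 * D" using y(4) y'(4) syms by linarith
    then have dist: "d (c s) (c s') \<le> 6 * D" "d (c s') (c s) \<le> 6 * D" using sym cX y(2) y'(2) by auto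
    have path: "real D - real \<kappa> / 2 - real k * \<delta> \<le> gprod d z0 (c i) (c j)"
      if ij: "i \<le> j" "j \<le> n" "d (c i) (c j) \<le> 6 * D" for i j
    proof -
      have "j - i \<le> \<kappa> * d (c i) (c j)" using qg ij unfolding quasi_geodesic_def by blast
      also have "\<dots> \<le> \<kappa> * (6 * D)" using ij(3) by (intro mult_le_mono2)
      finally have "j - i \<le> 2 ^ k" using k(1) by simp
      moreover have "d (c (i + l)) (c (i + Suc l)) \<le> \<kappa>" if "l < j - i" for l
      proof -
        have "i + Suc l \<le> n" "i + l \<le> i + Suc l" using that ij by auto
        then have "d (c (i + l)) (c (i + Suc l)) \<le> \<kappa> * (i + Suc l - (i + l))"
          using qg unfolding quasi_geodesic_def by blast
        then show ?thesis by simp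
      qed
      ultimately have "real D - real \<kappa> / 2 - real k * \<delta> \<le> gprod d z0 (c (i + 0)) (c (i + (j - i)))"
        using ij cX z0(2) by (intro gprod_path[OF z0X, of "j - i" "\<lambda>l. c (i + l)"]) auto
      then show ?thesis using ij by simp
    qed
    have mid: "real D - real \<kappa> / 2 - real k * \<delta> \<le> gprod d z0 (c s) (c s')"
    proof (cases "s \<le> s'")
      case True
      then show ?thesis using path dist y' by blast
    next
      case False
      then show ?thesis using path[of s' s] dist y y' gprod_sym[of "c s" "c s'" z0] cX by simp
    qed
    have "min (gprod d z0 y (c s)) (gprod d z0 (c s) y') - \<delta> \<le> gprod d z0 y y'"
      "min (gprod d z0 (c s) (c s')) (gprod d z0 (c s') y') - \<delta> \<le> gprod d z0 (c s) y'"
      using hyp z0X y y' cX by auto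
    moreover have "D \<le> gprod d z0 (c s') y'" using y'(5) gprod_sym[of y' "c s'"] y' cX by simp
    moreover have "0 \<le> real k * \<delta>" "0 \<le> real \<kappa> / 2" using \<delta> by auto
    ultimately have "real D - real \<kappa> / 2 - real k * \<delta> - 2 * \<delta> \<le> 0"
      using mid y(5) opp \<delta> by linarith
    then show False using k(2) by (simp add: mult.commute)
  qed
  then show ?thesis by blast
qed

text \<open>A connectedness argument: take the last distance from \<open>c 0\<close> at which a
  geodesic point is near the part of \<open>c\<close> up to \<open>t\<close>. The next point must be
  near the part after \<open>t\<close>, so two parameters on either side of \<open>t\<close> have
  close images and cannot be far apart. A bounded Gromov product expresses that \<open>c t\<close>
  is close to a geodesic without naming one.\<close>

lemma quasi_geodesic_gprod_bounded:
  "\<exists>C::nat. \<forall>c n t. quasi_geodesic \<kappa> c n \<longrightarrow> t \<le> n \<longrightarrow> gprod d (c t) (c 0) (c n) \<le> C"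
proof -
  obtain D0 where D0: "\<forall>c n z. quasi_geodesic \<kappa> c n \<longrightarrow> z \<in> X \<longrightarrow>
    d (c 0) z + d z (c n) = d (c 0) (c n) \<longrightarrow> (\<exists>t\<le>n. d z (c t) \<le> D0)"
    using geodesic_near_quasi_geodesic by blast
  \<comment> \<open>\<open>c s\<close> and \<open>c s'\<close> are within \<open>2 * D0 + 1\<close>;
    one factor \<open>\<kappa>\<close> turns this into a parameter gap, another into a distance from
    \<open>c s\<close> to \<open>c t\<close>. The last \<open>D0\<close> leads from \<open>z\<close>
    to \<open>c s\<close>.\<close>
  define C where "C = \<kappa> * (\<kappa> * (2 * D0 + 1)) + D0"
  have "gprod d (c t) (c 0) (c n) \<le> C" if qg: "quasi_geodesic \<kappa> c n" and t: "t \<le> n" for c n t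
  proof -
    have cX: "\<And>i. i \<le> n \<Longrightarrow> c i \<in> X" using qg by (simp add: quasi_geodesic_def)
    define S where "S k \<longleftrightarrow> (\<exists>z\<in>X. d (c 0) z + d z (c n) = d (c 0) (c n) \<and> d (c 0) z = k \<and> (\<exists>s\<le>t. d z (c s) \<le> D0))" for k
    have S0: "S 0" unfolding S_def using cX refl by (intro bexI[of _ "c 0"]) auto
    have S_le: "k \<le> d (c 0) (c n)" if "S k" for k using that unfolding S_def by auto
    define k where "k = (GREATEST k. S k)"
    have "S k" unfolding k_def using S0 S_le by (rule GreatestI_nat)
    then obtain z s where z: "z \<in> X" "d (c 0) z + d z (c n) = d (c 0) (c n)" "d (c 0) z = k" "s \<le> t" "d z (c s) \<le> D0"
      unfolding S_def by blast
    have "\<exists>s'\<ge>t. s' \<le> n \<and> d z (c s') \<le> D0 + 1"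
    proof (cases "d z (c n) = 0")
      case True
      then show ?thesis using t by (intro exI[of _ n]) auto
    next
      case False
      obtain z' where z': "z' \<in> X" "d z z' = 1" "d z' (c n) = d z (c n) - 1"
        using geod[of z "c n" 1] z(1) cX False by auto
      have "d (c 0) z' \<le> d (c 0) z + d z z'" "d (c 0) (c n) \<le> d (c 0) z' + d z' (c n)"
        using tri[of "c 0" z z'] tri[of "c 0" z' "c n"] z(1) z'(1) cX by auto
      then have b: "d (c 0) z' + d z' (c n) = d (c 0) (c n)" "d (c 0) z' = Suc k"
        using z z' False by linarith+
      have "\<not> S (Suc k)" using Greatest_le_nat[of S "Suc k", OF _ S_le] by (auto simp: k_def)
      then have far: "\<not> d z' (c s') \<le> D0" if "s' \<le> t" for s'
        using b z'(1) that unfolding S_def by blast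
      obtain s' where s': "s' \<le> n" "d z' (c s') \<le> D0" using D0 qg z'(1) b(1) by blast
      have "d z (c s') \<le> d z z' + d z' (c s')" using tri[of z z' "c s'"] z(1) z'(1) s' cX by auto
      moreover have "t \<le> s'" using far[of s'] s'(2) nat_le_linear by blast
      ultimately show ?thesis using s' z'(2) by (intro exI[of _ s']) auto
    qed
    then obtain s' where s': "t \<le> s'" "s' \<le> n" "d z (c s') \<le> D0 + 1" by blast
    have "d (c s) (c s') \<le> d z (c s) + d z (c s')"
      using tri[of "c s" z "c s'"] sym[of "c s" z] z s' t cX by auto
    then have "d (c s) (c s') \<le> 2 * D0 + 1" using z(5) s'(3) by linarith
    moreover have "s' - s \<le> \<kappa> * d (c s) (c s')"
      using qg z(4) s' t unfolding quasi_geodesic_def by (meson le_trans)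
    ultimately have "s' - s \<le> \<kappa> * (2 * D0 + 1)" by (meson le_trans mult_le_mono2)
    then have "t - s \<le> \<kappa> * (2 * D0 + 1)" using s' by linarith
    moreover have "d (c s) (c t) \<le> \<kappa> * (t - s)" using qg z(4) t unfolding quasi_geodesic_def by blast
    ultimately have "d (c s) (c t) \<le> \<kappa> * (\<kappa> * (2 * D0 + 1))" by (meson le_trans mult_le_mono2)
    moreover have "d z (c t) \<le> d z (c s) + d (c s) (c t)" using tri z t cX by auto
    ultimately have zC: "d z (c t) \<le> C" using z(5) by (simp add: C_def)
    have "d (c t) (c 0) \<le> d z (c t) + d (c 0) z" "d (c t) (c n) \<le> d z (c t) + d z (c n)"
      using tri[of "c t" z "c 0"] tri[of "c t" z "c n"] sym[of "c t" z] sym[of z "c 0"] z t cX by auto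
    then have "real (d (c t) (c 0)) + real (d (c t) (c n)) \<le> 2 * real C + real (d (c 0) (c n))"
      using zC z(2) by linarith
    then show ?thesis by (simp add: gprod_def)
  qed
  then show ?thesis by blast
qed

text \<open>Both points lie almost on a geodesic from \<open>c 0\<close> to \<open>c' n'\<close>. If
  \<open>s\<close> makes them about equally far from \<open>c 0\<close>, the four-point inequality
  based at \<open>c 0\<close>, with \<open>c' n'\<close> as intermediate point, forces them
  together.\<close>

lemma quasi_geodesics_fellow_travel:
  "\<exists>K. \<forall>c n c' n' t. quasi_geodesic \<kappa> c n \<longrightarrow> quasi_geodesic \<kappa> c' n' \<longrightarrow> c 0 = c' 0 \<longrightarrow>
    d (c n) (c' n') \<le> \<kappa> \<longrightarrow> t \<le> n \<longrightarrow> (\<exists>s\<le>n'. d (c t) (c' s) \<le> K)"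
proof -
  obtain C where C: "\<forall>c n t. quasi_geodesic \<kappa> c n \<longrightarrow> t \<le> n \<longrightarrow> gprod d (c t) (c 0) (c n) \<le> real C"
    using quasi_geodesic_gprod_bounded by blast
  \<comment> \<open>The two cases of the minimum give
    \<open>2 * (C + \<kappa>) + \<kappa> + 2 * \<delta>\<close> and
    \<open>4 * (C + \<kappa>) + 2 * \<delta>\<close>; \<open>K\<close> covers both.\<close>
  define K where "K = nat \<lceil>4 * (real C + real \<kappa>) + real \<kappa> + 2 * \<delta>\<rceil>"
  have "\<exists>s\<le>n'. d (c t) (c' s) \<le> K"
    if qg: "quasi_geodesic \<kappa> c n" "quasi_geodesic \<kappa> c' n'" and o: "c 0 = c' 0"
      and e: "d (c n) (c' n') \<le> \<kappa>" and t: "t \<le> n" for c n c' n' t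
  proof -
    define p where "p = c t"
    have X: "\<And>i. i \<le> n \<Longrightarrow> c i \<in> X" "\<And>i. i \<le> n' \<Longrightarrow> c' i \<in> X"
      using qg by (simp_all add: quasi_geodesic_def)
    have pX: "p \<in> X" "c 0 \<in> X" "c n \<in> X" "c' n' \<in> X" using X t by (auto simp: p_def)
    have pe: "d p (c 0) + d p (c n) \<le> d (c 0) (c n) + 2 * C"
      using C qg(1) t by (fastforce simp: p_def gprod_def)
    moreover have "d p (c' n') \<le> d p (c n) + \<kappa>" "d (c 0) (c n) \<le> d (c 0) (c' n') + \<kappa>"
      using tri[of p "c n" "c' n'"] tri[of "c 0" "c' n'" "c n"] sym[of "c n" "c' n'"] e pX by auto
    ultimately have p: "d (c 0) p + d p (c' n') \<le> d (c 0) (c' n') + 2 * (C + \<kappa>)"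
      using sym[of "c 0" p] pX by simp
    \<comment> \<open>Discrete intermediate value: the first \<open>s\<close> at which
      \<open>c'\<close> is as far from the start as \<open>p\<close> overshoots by at most \<kappa>.
      If the end of \<open>c'\<close> is no farther away than \<open>p\<close>, that end is
      taken.\<close>
    obtain s where s: "s \<le> n'" "d (c 0) p \<le> d (c 0) (c' s) + 2 * (C + \<kappa>)" "d (c 0) (c' s) \<le> d (c 0) p + \<kappa>"
    proof (cases "d (c 0) (c' n') \<le> d (c 0) p")
      case True
      then show ?thesis using p by (intro that[of n']) auto
    next
      case False
      define s where "s = (LEAST s. d (c 0) p \<le> d (c 0) (c' s))"
      have s1: "d (c 0) p \<le> d (c 0) (c' s)" unfolding s_def by (rule LeastI[of _ n']) (use False in simp)
      have s2: "s \<le> n'" unfolding s_def by (rule Least_le) (use False in simp)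
      show ?thesis
      proof (cases s)
        case 0
        then show ?thesis using s1 s2 o refl[OF pX(2)] by (intro that[of s]) auto
      next
        case (Suc r)
        then have "d (c 0) (c' r) < d (c 0) p"
          using not_less_Least[of r "\<lambda>s. d (c 0) p \<le> d (c 0) (c' s)"] by (simp add: s_def)
        moreover have "d (c' r) (c' s) \<le> \<kappa> * (s - r)"
          using qg(2) s2 Suc unfolding quasi_geodesic_def by (meson le_SucI order.refl)
        moreover have "d (c 0) (c' s) \<le> d (c 0) (c' r) + d (c' r) (c' s)" using tri pX X s2 Suc by auto
        ultimately show ?thesis using s1 s2 Suc by (intro that[of s]) auto
      qed
    qed
    define q where "q = c' s"
    have qX: "q \<in> X" using X s by (simp add: q_def)
    have "d q (c 0) + d q (c' n') \<le> d (c 0) (c' n') + 2 * C"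
      using C qg(2) s(1) o by (fastforce simp: q_def gprod_def)
    then have q: "d (c 0) q + d q (c' n') \<le> d (c 0) (c' n') + 2 * (C + \<kappa>)"
      using sym[of "c 0" q] pX qX by simp
    have "min (gprod d (c 0) p (c' n')) (gprod d (c 0) (c' n') q) - \<delta> \<le> gprod d (c 0) p q"
      using hyp pX qX by auto
    moreover have "real (d (c 0) p) - (real C + real \<kappa>) \<le> gprod d (c 0) p (c' n')"
      using of_nat_mono[OF p, where 'a = real] by (simp add: gprod_def field_simps)
    moreover have "real (d (c 0) q) - (real C + real \<kappa>) \<le> gprod d (c 0) (c' n') q"
      using of_nat_mono[OF q, where 'a = real] sym[of "c' n'" q] pX qX by (simp add: gprod_def field_simps)
    moreover have "real (d (c 0) p) \<le> real (d (c 0) q) + 2 * (real C + real \<kappa>)"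
      "real (d (c 0) q) \<le> real (d (c 0) p) + real \<kappa>" using s by (simp_all add: q_def)
    moreover have "real (d p q) = real (d (c 0) p) + real (d (c 0) q) - 2 * gprod d (c 0) p q"
      by (simp add: gprod_def field_simps)
    ultimately have "real (d p q) \<le> 4 * (real C + real \<kappa>) + real \<kappa> + 2 * \<delta>"
      by (simp add: min_def split: if_splits)
    then have "d p q \<le> K" unfolding K_def by linarith
    then show ?thesis using s by (auto simp: p_def q_def)
  qed
  then show ?thesis by blast
qed

end

section \<open>Hyperbolic groups\<close>

context generated_group
begin

abbreviation wl :: "'a \<Rightarrow> nat" where "wl \<equiv> word_length G ss"

abbreviation wd :: "'a \<Rightarrow> 'a \<Rightarrow> nat" where "wd g h \<equiv> word_length G ss (inv g \<otimes> h)"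

lemma word_length_le: "w \<in> lists (letters ss) \<Longrightarrow> wl (word_val G ss w) \<le> length w"
  unfolding word_length_def by (rule Least_le) blast

lemma word_length_witness:
  assumes "g \<in> carrier G"
  shows "\<exists>w\<in>lists (letters ss). length w = wl g \<and> word_val G ss w = g"
  unfolding word_length_def by (rule LeastI_ex) (use word_val_surj[OF assms] in blast)

lemma geodesic_iff_word_length:
  "geodesic G ss w \<longleftrightarrow> w \<in> lists (letters ss) \<and> wl (word_val G ss w) = length w"
proof
  assume g: "geodesic G ss w"
  then have w: "w \<in> lists (letters ss)" by (rule geodesic_letters)
  obtain v where "v \<in> lists (letters ss)" "length v = wl (word_val G ss w)" "word_val G ss v = word_val G ss w"
    using word_length_witness[OF word_val_closed[OF w]] by blast
  then have "length w \<le> wl (word_val G ss w)" using g unfolding geodesic_def by metis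
  then show "w \<in> lists (letters ss) \<and> wl (word_val G ss w) = length w"
    using w word_length_le[OF w] by simp
next
  assume w: "w \<in> lists (letters ss) \<and> wl (word_val G ss w) = length w"
  show "geodesic G ss w"
    unfolding geodesic_def using w word_length_le by metis
qed

lemma geodesic_word_exists:
  assumes "g \<in> carrier G"
  shows "\<exists>w. geodesic G ss w \<and> word_val G ss w = g \<and> length w = wl g"
  using word_length_witness[OF assms] unfolding geodesic_iff_word_length by metis

lemma word_length_one: "wl \<one> = 0"
  using word_length_le[of "[]"] by simp

lemma word_length_mult:
  assumes "g \<in> carrier G" "h \<in> carrier G"
  shows "wl (g \<otimes> h) \<le> wl g + wl h"
proof -
  obtain u v where uv: "u \<in> lists (letters ss)" "length u = wl g" "word_val G ss u = g"
    "v \<in> lists (letters ss)" "length v = wl h" "word_val G ss v = h"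
    using word_length_witness assms by metis
  then have "wl (word_val G ss (u @ v)) \<le> length (u @ v)" by (intro word_length_le) simp
  then show ?thesis using uv by (simp add: word_val_append)
qed

lemma word_length_inv:
  assumes "g \<in> carrier G"
  shows "wl (inv g) = wl g"
proof -
  have le: "wl (inv h) \<le> wl h" if h: "h \<in> carrier G" for h
  proof -
    obtain u where u: "u \<in> lists (letters ss)" "length u = wl h" "word_val G ss u = h"
      using word_length_witness[OF h] by blast
    then show ?thesis using word_length_le[OF inverse_word_letters[OF u(1)]]
      by (simp add: word_val_inverse_word)
  qed
  show ?thesis using le[of g] le[of "inv g"] assms by simp
qed

lemma word_length_letter: "l \<in> letters ss \<Longrightarrow> wl (letter_val G ss l) \<le> 1"
  using word_length_le[of "[l]"] by (simp add: word_val_single)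

lemma word_val_append_diff:
  assumes "u \<in> lists (letters ss)" "v \<in> lists (letters ss)"
  shows "inv (word_val G ss u) \<otimes> word_val G ss (u @ v) = word_val G ss v"
  using assms by (simp add: word_val_append word_val_closed m_assoc[symmetric])

lemma wd_sym: "g \<in> carrier G \<Longrightarrow> h \<in> carrier G \<Longrightarrow> wd g h = wd h g"
  using word_length_inv[of "inv g \<otimes> h"] by (simp add: inv_mult_group)

lemma wd_tri:
  assumes "g \<in> carrier G" "h \<in> carrier G" "k \<in> carrier G"
  shows "wd g k \<le> wd g h + wd h k"
proof -
  have "(inv g \<otimes> h) \<otimes> (inv h \<otimes> k) = inv g \<otimes> k"
    using assms by (simp add: m_assoc) (simp add: m_assoc[symmetric])
  then show ?thesis using word_length_mult[of "inv g \<otimes> h" "inv h \<otimes> k"] assms by simp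
qed

lemma wd_interpolate:
  assumes "x \<in> carrier G" "y \<in> carrier G" "k \<le> wd x y"
  shows "\<exists>z\<in>carrier G. wd x z = k \<and> wd z y = wd x y - k"
proof -
  obtain w where w: "geodesic G ss w" "word_val G ss w = inv x \<otimes> y" "length w = wd x y"
    using geodesic_word_exists[of "inv x \<otimes> y"] assms by auto
  have parts: "geodesic G ss (take k w)" "geodesic G ss (drop k w)"
    using geodesic_factor[of "[]" "take k w" "drop k w"] geodesic_factor[of "take k w" "drop k w" "[]"] w(1)
    by simp_all
  have l: "take k w \<in> lists (letters ss)" "drop k w \<in> lists (letters ss)"
    using parts geodesic_letters by blast+
  let ?z = "x \<otimes> word_val G ss (take k w)"
  have z: "?z \<in> carrier G" using assms l word_val_closed by simp
  have "inv x \<otimes> ?z = word_val G ss (take k w)"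
    using assms l by (simp add: m_assoc[symmetric] word_val_closed)
  then have "wd x ?z = k" using parts(1) w(3) assms(3) by (simp add: geodesic_iff_word_length)
  moreover have "inv ?z \<otimes> y = word_val G ss (drop k w)"
  proof -
    have "inv ?z \<otimes> y = inv (word_val G ss (take k w)) \<otimes> (inv x \<otimes> y)"
      using assms l by (simp add: inv_mult_group m_assoc word_val_closed)
    also have "inv x \<otimes> y = word_val G ss (take k w @ drop k w)" using w(2) by simp
    finally show ?thesis using word_val_append_diff[OF l] by simp
  qed
  then have "wd ?z y = wd x y - k" using parts(2) w(3) by (simp add: geodesic_iff_word_length)
  ultimately show ?thesis using z by blast
qed

lemma hyperbolic_metric_wd:
  assumes "0 \<le> \<delta>"
    and "\<forall>w\<in>carrier G. \<forall>x\<in>carrier G. \<forall>y\<in>carrier G. \<forall>z\<in>carrier G.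
      gromov_product G ss w x y \<ge> min (gromov_product G ss w x z) (gromov_product G ss w y z) - \<delta>"
  shows "hyperbolic_metric (carrier G) wd \<delta>"
proof
  have eq: "gprod wd w x y = gromov_product G ss w x y" for w x y
    by (simp add: gprod_def gromov_product_def word_dist_def)
  fix w x y z assume c: "w \<in> carrier G" "x \<in> carrier G" "y \<in> carrier G" "z \<in> carrier G"
  have "gromov_product G ss w y z = gromov_product G ss w z y"
    using wd_sym[OF c(3,4)] by (simp add: gromov_product_def word_dist_def)
  then show "min (gprod wd w x z) (gprod wd w z y) - \<delta> \<le> gprod wd w x y"
    using assms(2) c unfolding eq by metis
qed (use assms(1) in \<open>auto simp: word_length_one intro: wd_sym wd_tri wd_interpolate\<close>)

text \<open>\<open>K\<close> bounds the lengths over \<open>ts\<close> of the finitely many letters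
  of \<open>ss\<close>. Applied in both directions, this makes the two word metrics bi-Lipschitz
  equivalent.\<close>

lemma word_length_Lipschitz:
  assumes "generated_group G ts"
  shows "\<exists>K. \<forall>g\<in>carrier G. word_length G ts g \<le> K * wl g"
proof -
  interpret T: generated_group G ts by fact
  have "finite ((\<lambda>l. T.wl (letter_val G ss l)) ` letters ss)" using finite_letters by blast
  then obtain K where "\<forall>k\<in>(\<lambda>l. T.wl (letter_val G ss l)) ` letters ss. k \<le> K"
    unfolding finite_nat_set_iff_bounded_le ..
  then have K: "T.wl (letter_val G ss l) \<le> K" if "l \<in> letters ss" for l using that by blast
  have words: "T.wl (word_val G ss w) \<le> K * length w" if "w \<in> lists (letters ss)" for w
    using that
  proof (induction w rule: list.induct)
    case (Cons l w)
    then have "T.wl (word_val G ss (l # w)) \<le> T.wl (letter_val G ss l) + T.wl (word_val G ss w)"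
      unfolding word_val_Cons by (intro T.word_length_mult) (auto simp: letter_val_closed word_val_closed)
    also have "\<dots> \<le> K + K * length w" using K Cons by (intro add_mono) auto
    finally show ?case by simp
  qed (simp add: T.word_length_one)
  have "T.wl g \<le> K * wl g" if "g \<in> carrier G" for g
    using word_length_witness[OF that] words by metis
  then show ?thesis by blast
qed

section \<open>Fellow travelling of geodesic words\<close>

lemma geodesic_prefix_dist:
  assumes "geodesic G ss w" "i \<le> j" "j \<le> length w"
  shows "wd (word_val G ss (take i w)) (word_val G ss (take j w)) = j - i"
proof -
  have split: "take j w = take i w @ drop i (take j w)"
    using assms(2) append_take_drop_id[of i "take j w"] by (simp add: min_absorb1)
  have "w = take i w @ drop i (take j w) @ drop j w"
    using split append_take_drop_id[of j w] by (metis append.assoc)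
  then have g: "geodesic G ss (drop i (take j w))"
    using assms(1) geodesic_factor by metis
  have "take j w \<in> lists (letters ss)"
    using geodesic_letters[OF assms(1)] by (auto dest: in_set_takeD)
  then have "take i w \<in> lists (letters ss)" "drop i (take j w) \<in> lists (letters ss)"
    using split by (metis append_in_lists_conv)+
  then have "inv (word_val G ss (take i w)) \<otimes> word_val G ss (take j w) = word_val G ss (drop i (take j w))"
    using word_val_append_diff split by metis
  then show ?thesis using g assms(3) by (simp add: geodesic_iff_word_length)
qed

lemma geodesic_take_letters: "geodesic G ss w \<Longrightarrow> take i w \<in> lists (letters ss)"
  using geodesic_letters[of G ss w] by (auto dest: in_set_takeD)

text \<open>Stability only gives closeness at unrelated times \<open>t\<close> and \<open>s\<close>.
  It becomes synchronous because a geodesic prefix has its length as distance from the identity, so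
  the times differ by at most the distance of the points.\<close>

lemma geodesics_fellow_travel:
  assumes "hyperbolic_group G"
  shows "\<exists>K. \<forall>u v t. geodesic G ss u \<longrightarrow> geodesic G ss v \<longrightarrow>
    wd (word_val G ss u) (word_val G ss v) \<le> 1 \<longrightarrow> t \<le> length u \<longrightarrow>
    wd (word_val G ss (take t u)) (word_val G ss (take t v)) \<le> K"
proof -
  obtain ts \<delta> where ts: "fin_gen_set G ts" "0 \<le> \<delta>"
    "\<forall>w\<in>carrier G. \<forall>x\<in>carrier G. \<forall>y\<in>carrier G. \<forall>z\<in>carrier G.
      gromov_product G ts w x y \<ge> min (gromov_product G ts w x z) (gromov_product G ts w y z) - \<delta>"
    using assms unfolding hyperbolic_group_def by blast
  interpret T: generated_group G ts by unfold_locales (rule ts(1))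
  interpret H: hyperbolic_metric "carrier G" T.wd \<delta> by (rule T.hyperbolic_metric_wd[OF ts(2,3)])
  obtain K1 where K1: "\<forall>g\<in>carrier G. T.wl g \<le> K1 * wl g"
    using word_length_Lipschitz[OF T.generated_group_axioms] by blast
  obtain K2 where K2: "\<forall>g\<in>carrier G. wl g \<le> K2 * T.wl g"
    using T.word_length_Lipschitz[OF generated_group_axioms] by blast
  \<comment> \<open>One constant for both comparisons; it also bounds the \<open>ts\<close>-distance
    of endpoints that are at most 1 apart over \<open>ss\<close>.\<close>
  define \<kappa> where "\<kappa> = max K1 K2"
  have K1': "T.wl g \<le> \<kappa> * wl g" if "g \<in> carrier G" for g
    using K1[rule_format, OF that] mult_le_mono1[of K1 \<kappa> "wl g"] unfolding \<kappa>_def by linarith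
  have K2': "wl g \<le> \<kappa> * T.wl g" if "g \<in> carrier G" for g
    using K2[rule_format, OF that] mult_le_mono1[of K2 \<kappa> "T.wl g"] unfolding \<kappa>_def by linarith
  have qg: "H.quasi_geodesic \<kappa> (\<lambda>i. word_val G ss (take i w)) (length w)" if w: "geodesic G ss w" for w
    unfolding H.quasi_geodesic_def
  proof (intro conjI allI impI)
    fix i j assume ij: "j \<le> length w" "i \<le> j"
    let ?a = "word_val G ss (take i w)" and ?b = "word_val G ss (take j w)"
    have c: "inv ?a \<otimes> ?b \<in> carrier G" using geodesic_take_letters[OF w] word_val_closed by simp
    show "T.wd ?a ?b \<le> \<kappa> * (j - i)" "j - i \<le> \<kappa> * T.wd ?a ?b"
      using K1'[OF c] K2'[OF c] geodesic_prefix_dist[OF w ij(2,1)] by simp_all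
  qed (use geodesic_take_letters[OF w] word_val_closed in blast)
  obtain K where K: "\<forall>c n c' n' t. H.quasi_geodesic \<kappa> c n \<longrightarrow> H.quasi_geodesic \<kappa> c' n' \<longrightarrow> c 0 = c' 0 \<longrightarrow>
    T.wd (c n) (c' n') \<le> \<kappa> \<longrightarrow> t \<le> n \<longrightarrow> (\<exists>s\<le>n'. T.wd (c t) (c' s) \<le> K)"
    using H.quasi_geodesics_fellow_travel by blast
  \<comment> \<open>One \<open>\<kappa> * K\<close> for crossing over to \<open>v\<close>, the other
    for moving along \<open>v\<close> to time \<open>t\<close>.\<close>
  have "wd (word_val G ss (take t u)) (word_val G ss (take t v)) \<le> 2 * (\<kappa> * K)"
    if u: "geodesic G ss u" and v: "geodesic G ss v"
      and e: "wd (word_val G ss u) (word_val G ss v) \<le> 1" and t: "t \<le> length u" for u v t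
  proof -
    have cl: "word_val G ss (take i u) \<in> carrier G" "word_val G ss (take i v) \<in> carrier G" for i
      using geodesic_take_letters[OF u] geodesic_take_letters[OF v] word_val_closed by blast+
    have "T.wd (word_val G ss u) (word_val G ss v) \<le> \<kappa> * wd (word_val G ss u) (word_val G ss v)"
      using cl(1)[of "length u"] cl(2)[of "length v"] by (intro K1') simp
    also have "\<dots> \<le> \<kappa> * 1" using e by (intro mult_le_mono2)
    finally have "T.wd (word_val G ss u) (word_val G ss v) \<le> \<kappa>" by simp
    then obtain s where s: "s \<le> length v" "T.wd (word_val G ss (take t u)) (word_val G ss (take s v)) \<le> K"
      using K[rule_format, OF qg[OF u] qg[OF v], of t] t by auto
    let ?p = "word_val G ss (take t u)" and ?q = "word_val G ss (take s v)"
    have "wd ?p ?q \<le> \<kappa> * T.wd ?p ?q" using cl by (intro K2') simp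
    also have "\<dots> \<le> \<kappa> * K" using s(2) by (intro mult_le_mono2)
    finally have pq: "wd ?p ?q \<le> \<kappa> * K" .
    have p: "wd \<one> ?p = t" using geodesic_prefix_dist[OF u, of 0 t] t by simp
    have q: "wd \<one> ?q = s" using geodesic_prefix_dist[OF v, of 0 s] s by simp
    have st: "t \<le> s + wd ?p ?q" "s \<le> t + wd ?p ?q"
      using wd_tri[of \<one> ?q ?p] wd_tri[of \<one> ?p ?q] wd_sym[of ?p ?q] cl p q by auto
    define t' where "t' = min t (length v)"
    have t': "take t v = take t' v" "t' \<le> length v" by (auto simp: t'_def min_def)
    have "wd ?q (word_val G ss (take t' v)) \<le> \<kappa> * K"
    proof (cases "s \<le> t'")
      case True
      then show ?thesis using geodesic_prefix_dist[OF v True t'(2)] st pq by (simp add: t'_def)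
    next
      case False
      then have "t' \<le> s" by simp
      from geodesic_prefix_dist[OF v this s(1)]
      have "wd ?q (word_val G ss (take t' v)) = s - t'" using wd_sym cl by metis
      then show ?thesis using False st pq s(1) by (simp add: t'_def min_def split: if_splits)
    qed
    then show ?thesis
      using wd_tri[of ?p ?q "word_val G ss (take t' v)"] cl pq t'(1) by fastforce
  qed
  then show ?thesis by blast
qed

text \<open>Cannon's cone types: the set of geodesic continuations of a geodesic word \<open>w\<close> is determined by
  the function \<open>g \<mapsto> |wg| - |w|\<close> on a ball of fixed radius.\<close>

lemma geodesic_continuation_transfer:
  assumes K: "\<forall>u v t. geodesic G ss u \<longrightarrow> geodesic G ss v \<longrightarrow>
      wd (word_val G ss u) (word_val G ss v) \<le> 1 \<longrightarrow> t \<le> length u \<longrightarrow>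
      wd (word_val G ss (take t u)) (word_val G ss (take t v)) \<le> K"
    and u: "geodesic G ss u" and v: "geodesic G ss v"
    and type: "\<And>g. g \<in> carrier G \<Longrightarrow> wl g \<le> K \<Longrightarrow>
      int (wl (word_val G ss u \<otimes> g)) - int (length u) = int (wl (word_val G ss v \<otimes> g)) - int (length v)"
  shows "geodesic G ss (u @ w) \<Longrightarrow> geodesic G ss (v @ w)"
proof (induction w rule: rev_induct)
  case Nil
  then show ?case using v by simp
next
  case (snoc a w)
  have uw: "geodesic G ss (u @ w)"
    using geodesic_factor[of "[]" "u @ w" "[a]"] snoc.prems by simp
  then have vw: "geodesic G ss (v @ w)" by (rule snoc.IH)
  have l: "u \<in> lists (letters ss)" "v \<in> lists (letters ss)" "w \<in> lists (letters ss)" "a \<in> letters ss"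
    "w @ [a] \<in> lists (letters ss)"
    using geodesic_letters[OF snoc.prems] geodesic_letters[OF v] by auto
  have cl: "word_val G ss u \<in> carrier G" "word_val G ss v \<in> carrier G" "word_val G ss (w @ [a]) \<in> carrier G"
    using l word_val_closed by auto
  show ?case
  proof (rule ccontr)
    assume "\<not> geodesic G ss (v @ w @ [a])"
    moreover have vwa: "v @ w @ [a] \<in> lists (letters ss)" using l by simp
    ultimately have short: "wl (word_val G ss (v @ w @ [a])) < length (v @ w @ [a])"
      using word_length_le[OF vwa] unfolding geodesic_iff_word_length by linarith
    obtain x where x: "geodesic G ss x" "word_val G ss x = word_val G ss (v @ w @ [a])"
      "length x = wl (word_val G ss (v @ w @ [a]))"
      using geodesic_word_exists[OF word_val_closed[OF vwa]] by blast
    have "inv (word_val G ss (v @ w)) \<otimes> word_val G ss ((v @ w) @ [a]) = word_val G ss [a]"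
      using l by (intro word_val_append_diff) auto
    then have "wd (word_val G ss (v @ w)) (word_val G ss x) \<le> 1"
      using word_length_letter[OF l(4)] l(4) x(2) by (simp add: word_val_single)
    then have near: "wd (word_val G ss (take (length v) (v @ w))) (word_val G ss (take (length v) x)) \<le> K"
      using K vw x(1) by (metis le_add1 length_append)
    \<comment> \<open>The shorter word \<open>x\<close> is compared at the time when
      \<open>v @ w\<close> has just completed \<open>v\<close>. If \<open>x\<close> ends earlier,
      \<open>y\<close> is all of \<open>x\<close>, so \<open>length y\<close> may differ from
      \<open>length v\<close>.\<close>
    define y where "y = take (length v) x"
    define z where "z = drop (length v) x"
    have xyz: "x = y @ z" by (simp add: y_def z_def)
    have yz: "y \<in> lists (letters ss)" "z \<in> lists (letters ss)"
      using geodesic_letters[OF x(1)] unfolding xyz by auto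
    have y: "wl (word_val G ss y) = length y"
      using geodesic_factor[of "[]" y z] x(1) xyz by (simp add: geodesic_iff_word_length)
    \<comment> \<open>\<open>g\<close> leads from the end of \<open>v\<close> to the shortcut and
      lies in the ball on which the types of \<open>u\<close> and \<open>v\<close> agree, so the
      shortcut can be transplanted to \<open>u\<close>.\<close>
    define g where "g = inv (word_val G ss v) \<otimes> word_val G ss y"
    have g: "g \<in> carrier G" "wl g \<le> K" using near cl yz word_val_closed by (simp_all add: g_def y_def)
    have vg: "word_val G ss v \<otimes> g = word_val G ss y"
      using cl yz word_val_closed by (simp add: g_def m_assoc[symmetric])
    have gz: "g \<otimes> word_val G ss z = word_val G ss (w @ [a])"
    proof -
      have "g \<otimes> word_val G ss z = inv (word_val G ss v) \<otimes> word_val G ss x"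
        using cl yz by (simp add: g_def xyz word_val_append word_val_closed m_assoc)
      also have "\<dots> = word_val G ss (w @ [a])"
        unfolding x(2) using l by (intro word_val_append_diff) auto
      finally show ?thesis .
    qed
    \<comment> \<open>The transplanted route has length at most
      \<open>length u + length y - length v + length z\<close>, which is less than
      \<open>length u + length w + 1\<close>.\<close>
    have "word_val G ss (u @ w @ [a]) = (word_val G ss u \<otimes> g) \<otimes> word_val G ss z"
      using l cl g yz gz word_val_closed by (simp add: word_val_append[of u "w @ [a]"] m_assoc)
    then have "wl (word_val G ss (u @ w @ [a])) \<le> wl (word_val G ss u \<otimes> g) + wl (word_val G ss z)"
      using word_length_mult[of "word_val G ss u \<otimes> g" "word_val G ss z"] cl g yz word_val_closed by simp
    also have "\<dots> \<le> wl (word_val G ss u \<otimes> g) + length z" using word_length_le[OF yz(2)] by simp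
    finally have "length (u @ w @ [a]) \<le> wl (word_val G ss u \<otimes> g) + length z"
      using snoc.prems by (simp add: geodesic_iff_word_length)
    moreover have "int (wl (word_val G ss u \<otimes> g)) = int (length u) + int (length y) - int (length v)"
      using type[OF g] vg y by simp
    moreover have "length y + length z = length x" using xyz by simp
    ultimately show False using short x(3) by simp
  qed
qed

lemma finite_ball: "finite {g \<in> carrier G. wl g \<le> K}"
proof (rule finite_subset)
  show "{g \<in> carrier G. wl g \<le> K} \<subseteq> word_val G ss ` {w. set w \<subseteq> letters ss \<and> length w \<le> K}"
  proof
    fix g assume "g \<in> {g \<in> carrier G. wl g \<le> K}"
    then obtain w where "w \<in> lists (letters ss)" "length w \<le> K" "word_val G ss w = g"
      using word_length_witness[of g] by (metis (no_types, lifting) mem_Collect_eq)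
    then show "g \<in> word_val G ss ` {w. set w \<subseteq> letters ss \<and> length w \<le> K}" by (auto simp: in_lists_conv_set)
  qed
  show "finite (word_val G ss ` {w. set w \<subseteq> letters ss \<and> length w \<le> K})"
    by (intro finite_imageI finite_lists_length_le finite_letters)
qed

text \<open>Non-geodesic words have no geodesic continuation and share the value
  \<open>None\<close>. For geodesic words the triangle inequality confines the type to values
  between \<open>-K\<close> and \<open>K\<close> on a finite ball, so finitely many types
  occur.\<close>

lemma regular_Geo_hyperbolic:
  assumes "hyperbolic_group G"
  shows "regular_lang (letters ss) (Geo G ss)"
proof -
  obtain K where K: "\<forall>u v t. geodesic G ss u \<longrightarrow> geodesic G ss v \<longrightarrow>
      wd (word_val G ss u) (word_val G ss v) \<le> 1 \<longrightarrow> t \<le> length u \<longrightarrow>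
      wd (word_val G ss (take t u)) (word_val G ss (take t v)) \<le> K"
    using geodesics_fellow_travel[OF assms] by blast
  define B where "B = {g \<in> carrier G. wl g \<le> K}"
  define \<tau> where "\<tau> u = (\<lambda>g. if g \<in> B then int (wl (word_val G ss u \<otimes> g)) - int (length u) else 0)" for u
  define \<phi> where "\<phi> u = (if geodesic G ss u then Some (\<tau> u) else None)" for u
  let ?T = "{f. \<forall>g. (g \<in> B \<longrightarrow> f g \<in> {-int K..int K}) \<and> (g \<notin> B \<longrightarrow> f g = 0)}"
  show ?thesis
  proof (rule regular_lang_if_finite_index)
    show "Geo G ss \<subseteq> lists (letters ss)" by (auto simp: Geo_def geodesic_def)
    have "\<tau> u \<in> ?T" if u: "geodesic G ss u" for u
    proof -
      have "int (wl (word_val G ss u \<otimes> g)) - int (length u) \<in> {-int K..int K}" if g: "g \<in> B" for g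
      proof -
        have uc: "word_val G ss u \<in> carrier G" "wl (word_val G ss u) = length u"
          using u word_val_closed by (auto simp: geodesic_iff_word_length)
        have gc: "g \<in> carrier G" "wl g \<le> K" using g by (auto simp: B_def)
        have "wl (word_val G ss u \<otimes> g) \<le> length u + wl g" using word_length_mult uc gc by metis
        moreover have "wl ((word_val G ss u \<otimes> g) \<otimes> inv g) \<le> wl (word_val G ss u \<otimes> g) + wl (inv g)"
          using uc gc by (intro word_length_mult) auto
        then have "length u \<le> wl (word_val G ss u \<otimes> g) + wl g"
          using uc gc by (simp add: m_assoc word_length_inv)
        ultimately show ?thesis using gc by auto
      qed
      then show ?thesis by (simp add: \<tau>_def)
    qed
    then have "\<phi> ` lists (letters ss) \<subseteq> insert None (Some ` ?T)" unfolding \<phi>_def by auto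
    moreover have "finite ?T" unfolding B_def by (intro finite_set_of_finite_funs finite_ball) simp
    ultimately show "finite (\<phi> ` lists (letters ss))" by (meson finite.insertI finite_imageI finite_subset)
    fix u v w assume eq: "\<phi> u = \<phi> v"
    have transfer: "geodesic G ss (v @ w)" if uw: "geodesic G ss (u @ w)" and eq: "\<phi> u = \<phi> v" for u v
    proof -
      have u: "geodesic G ss u" using geodesic_factor[of "[]" u w] uw by simp
      then have v: "geodesic G ss v" and t: "\<tau> u = \<tau> v" using eq by (auto simp: \<phi>_def split: if_splits)
      show ?thesis
      proof (rule geodesic_continuation_transfer[OF K u v _ uw])
        fix g assume "g \<in> carrier G" "wl g \<le> K"
        then show "int (wl (word_val G ss u \<otimes> g)) - int (length u) = int (wl (word_val G ss v \<otimes> g)) - int (length v)"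
          using fun_cong[OF t, of g] by (simp add: \<tau>_def B_def)
      qed
    qed
    show "u @ w \<in> Geo G ss \<longleftrightarrow> v @ w \<in> Geo G ss"
      using transfer[OF _ eq] transfer[OF _ eq[symmetric]] unfolding Geo_def by blast
  qed
qed

end

theorem theorem3:
  shows "(\<forall>(G :: 'a monoid) ss. group G \<and> fin_gen_set G ss \<and> regular_lang (letters ss) (Geo G ss)
            \<longrightarrow> geodesic_snake_decidable G ss)
       \<and> (\<forall>(G :: 'a monoid) ss. comm_group G \<and> fin_gen_set G ss
            \<longrightarrow> geodesic_snake_decidable G ss)
       \<and> (\<forall>(G :: 'a monoid) ss. hyperbolic_group G \<and> fin_gen_set G ss
            \<longrightarrow> geodesic_snake_decidable G ss)"
proof (intro conjI allI impI; elim conjE)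
  fix G :: "'a monoid" and ss
  assume gen: "fin_gen_set G ss"
  have gg: "generated_group G ss" if "group G"
    using that gen by (simp add: generated_group_def generated_group_axioms_def)
  show "geodesic_snake_decidable G ss" if "group G" "regular_lang (letters ss) (Geo G ss)"
    using generated_group.regular_Geo_imp_decidable[OF gg] that by blast
  show "geodesic_snake_decidable G ss" if "comm_group G"
    using generated_group.regular_Geo_imp_decidable generated_group.regular_Geo_abelian gg
      comm_group.axioms(2) that by blast
  show "geodesic_snake_decidable G ss" if "hyperbolic_group G"
    using generated_group.regular_Geo_imp_decidable generated_group.regular_Geo_hyperbolic gg that
    unfolding hyperbolic_group_def by blast
qed

end
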